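(* Let $\mathcal{A}$ be an abelian category with enough projective objects, let $\mathcal{X}$ be a subcategory of $\mathcal{A}$, and let $M$, $N$ be objects in $\mathcal{A}$. Assume that $M$ admits a proper $\mathcal{X}$-resolution. Then for each integer $n$ there is an isomorphism of abelian groups $$\mathrm{Ext}^{n}_{\mathcal{X}\mathcal{A}}(M,N)\cong \mathrm{Hom}_{\mathbf{D}^{b}_{\mathcal{X}}(\mathcal{A})}(M,N[n]).$$
   Context: Conventions: "subcategory" of $\mathcal{A}$ means a full additive subcategory closed under isomorphisms. Complexes are indexed cohomologically (differentials raise degree); $\mathbf{X}[n]^{m}=X^{n+m}$ with differential $(-1)^n\delta_{\mathbf{X}}^{n+m}$; an object of $\mathcal{A}$ is identified with the complex concentrated in degree $0$. An $\mathcal{X}$-resolution of $M$ is a complex $\mathbf{X}$ with $X^{i}\in\mathcal{X}$ for $i\leq 0$, $X^{i}=0$ for $i>0$, $\mathrm{H}^{i}(\mathbf{X})=0$ for $i<0$ and $\mathrm{H}^{0}(\mathbf{X})\cong M$. It is proper if the associated exact sequence $\cdots\to X^{-1}\to X^{0}\to M\to 0$ remains exact after applying $\mathrm{Hom}_{\mathcal{A}}(X,-)$ for every $X\in\mathcal{X}$. If $\mathbf{X}$ is a proper $\mathcal{X}$-resolution of $M$, the relative cohomology groups are $\mathrm{Ext}^{n}_{\mathcal{X}\mathcal{A}}(M,N):=\mathrm{H}^{n}(\mathrm{Hom}_{\mathcal{A}}(\mathbf{X},N))$ (independent of the choice of $\mathbf{X}$ up to canonical isomorphism). A complex $\mathbf{S}$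 is $\mathcal{X}$-acyclic if $\mathrm{Hom}_{\mathcal{A}}(X,\mathbf{S})$ is acyclic for each $X\in\mathcal{X}$. $\mathbf{K}^{b}(\mathcal{A})$ is the homotopy category of bounded complexes in $\mathcal{A}$, $\mathbf{K}^{b}_{\mathcal{X}}(\mathcal{A})$ its full subcategory of $\mathcal{X}$-acyclic complexes, and $\mathbf{D}^{b}_{\mathcal{X}}(\mathcal{A}):=\mathbf{K}^{b}(\mathcal{A})/\mathbf{K}^{b}_{\mathcal{X}}(\mathcal{A})$ is the Verdier quotient. *)

theory Defs
  imports "HOL-Algebra.Coset"
begin

section \<open>Preadditive, additive and abelian categories\<close>

text \<open>
  The abelian group of morphisms from \<open>X\<close> to \<open>Y\<close> is a HOL-Algebra group, hence written
  multiplicatively: \<open>f \<otimes> g\<close> is the sum of two parallel morphisms and \<open>\<one>\<close> is the zero morphism.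
  Morphism sets are not required to be disjoint, so composition takes the objects as arguments:
  \<open>Comp A X Y Z g f\<close> is \<open>g \<circ> f\<close> for \<open>f : X \<rightarrow> Y\<close> and \<open>g : Y \<rightarrow> Z\<close>.
\<close>

record ('o, 'm) preadd =
  Ob :: "'o set"
  Hom :: "'o \<Rightarrow> 'o \<Rightarrow> 'm monoid"
  Ident :: "'o \<Rightarrow> 'm"
  Comp :: "'o \<Rightarrow> 'o \<Rightarrow> 'o \<Rightarrow> 'm \<Rightarrow> 'm \<Rightarrow> 'm"

abbreviation Mor :: "('o, 'm) preadd \<Rightarrow> 'o \<Rightarrow> 'o \<Rightarrow> 'm set"
  where "Mor A X Y \<equiv> carrier (Hom A X Y)"

abbreviation Zero :: "('o, 'm) preadd \<Rightarrow> 'o \<Rightarrow> 'o \<Rightarrow> 'm"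
  where "Zero A X Y \<equiv> \<one>\<^bsub>Hom A X Y\<^esub>"

abbreviation Add :: "('o, 'm) preadd \<Rightarrow> 'o \<Rightarrow> 'o \<Rightarrow> 'm \<Rightarrow> 'm \<Rightarrow> 'm"
  where "Add A X Y f g \<equiv> f \<otimes>\<^bsub>Hom A X Y\<^esub> g"

abbreviation Neg :: "('o, 'm) preadd \<Rightarrow> 'o \<Rightarrow> 'o \<Rightarrow> 'm \<Rightarrow> 'm"
  where "Neg A X Y f \<equiv> inv\<^bsub>Hom A X Y\<^esub> f"

locale preadditive_category =
  fixes A :: "('o, 'm) preadd"
  assumes Hom_group: "\<lbrakk>X \<in> Ob A; Y \<in> Ob A\<rbrakk> \<Longrightarrow> comm_group (Hom A X Y)"
    and Ident_closed: "X \<in> Ob A \<Longrightarrow> Ident A X \<in> Mor A X X"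
    and Comp_closed:
      "\<lbrakk>X \<in> Ob A; Y \<in> Ob A; Z \<in> Ob A; f \<in> Mor A X Y; g \<in> Mor A Y Z\<rbrakk>
        \<Longrightarrow> Comp A X Y Z g f \<in> Mor A X Z"
    and Comp_Ident_left:
      "\<lbrakk>X \<in> Ob A; Y \<in> Ob A; f \<in> Mor A X Y\<rbrakk> \<Longrightarrow> Comp A X Y Y (Ident A Y) f = f"
    and Comp_Ident_right:
      "\<lbrakk>X \<in> Ob A; Y \<in> Ob A; f \<in> Mor A X Y\<rbrakk> \<Longrightarrow> Comp A X X Y f (Ident A X) = f"
    and Comp_assoc:
      "\<lbrakk>W \<in> Ob A; X \<in> Ob A; Y \<in> Ob A; Z \<in> Ob A;
        f \<in> Mor A W X; g \<in> Mor A X Y; h \<in> Mor A Y Z\<rbrakk>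
        \<Longrightarrow> Comp A W X Z (Comp A X Y Z h g) f = Comp A W Y Z h (Comp A W X Y g f)"
    and Comp_Add_left:
      "\<lbrakk>X \<in> Ob A; Y \<in> Ob A; Z \<in> Ob A; f \<in> Mor A X Y; g \<in> Mor A Y Z; h \<in> Mor A Y Z\<rbrakk>
        \<Longrightarrow> Comp A X Y Z (Add A Y Z g h) f = Add A X Z (Comp A X Y Z g f) (Comp A X Y Z h f)"
    and Comp_Add_right:
      "\<lbrakk>X \<in> Ob A; Y \<in> Ob A; Z \<in> Ob A; f \<in> Mor A X Y; g \<in> Mor A X Y; h \<in> Mor A Y Z\<rbrakk>
        \<Longrightarrow> Comp A X Y Z h (Add A X Y f g) = Add A X Z (Comp A X Y Z h f) (Comp A X Y Z h g)"

definition is_iso_mor :: "('o, 'm) preadd \<Rightarrow> 'o \<Rightarrow> 'o \<Rightarrow> 'm \<Rightarrow> bool"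
  where "is_iso_mor A X Y f \<longleftrightarrow> f \<in> Mor A X Y \<and>
    (\<exists>g \<in> Mor A Y X. Comp A X Y X g f = Ident A X \<and> Comp A Y X Y f g = Ident A Y)"

definition isomorphic_ob :: "('o, 'm) preadd \<Rightarrow> 'o \<Rightarrow> 'o \<Rightarrow> bool"
  where "isomorphic_ob A X Y \<longleftrightarrow> (\<exists>f. is_iso_mor A X Y f)"

definition is_zero_ob :: "('o, 'm) preadd \<Rightarrow> 'o \<Rightarrow> bool"
  where "is_zero_ob A Z \<longleftrightarrow> Z \<in> Ob A \<and>
    (\<forall>X \<in> Ob A. (\<exists>!f. f \<in> Mor A Z X) \<and> (\<exists>!f. f \<in> Mor A X Z))"

definition zero_ob :: "('o, 'm) preadd \<Rightarrow> 'o"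
  where "zero_ob A = (SOME Z. is_zero_ob A Z)"

definition is_biproduct ::
    "('o, 'm) preadd \<Rightarrow> 'o \<Rightarrow> 'o \<Rightarrow> 'o \<Rightarrow> 'm \<Rightarrow> 'm \<Rightarrow> 'm \<Rightarrow> 'm \<Rightarrow> bool"
  where "is_biproduct A X Y B i1 i2 p1 p2 \<longleftrightarrow>
    B \<in> Ob A \<and> i1 \<in> Mor A X B \<and> i2 \<in> Mor A Y B \<and> p1 \<in> Mor A B X \<and> p2 \<in> Mor A B Y \<and>
    Comp A X B X p1 i1 = Ident A X \<and> Comp A Y B Y p2 i2 = Ident A Y \<and>
    Comp A X B Y p2 i1 = Zero A X Y \<and> Comp A Y B X p1 i2 = Zero A Y X \<and>
    Add A B B (Comp A B X B i1 p1) (Comp A B Y B i2 p2) = Ident A B"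

definition is_kernel :: "('o, 'm) preadd \<Rightarrow> 'o \<Rightarrow> 'o \<Rightarrow> 'm \<Rightarrow> 'o \<Rightarrow> 'm \<Rightarrow> bool"
  where "is_kernel A X Y f K k \<longleftrightarrow>
    K \<in> Ob A \<and> k \<in> Mor A K X \<and> Comp A K X Y f k = Zero A K Y \<and>
    (\<forall>W \<in> Ob A. \<forall>g \<in> Mor A W X. Comp A W X Y f g = Zero A W Y \<longrightarrow>
      (\<exists>!h. h \<in> Mor A W K \<and> Comp A W K X k h = g))"

definition is_cokernel :: "('o, 'm) preadd \<Rightarrow> 'o \<Rightarrow> 'o \<Rightarrow> 'm \<Rightarrow> 'o \<Rightarrow> 'm \<Rightarrow> bool"
  where "is_cokernel A X Y f Q q \<longleftrightarrow>
    Q \<in> Ob A \<and> q \<in> Mor A Y Q \<and> Comp A X Y Q q f = Zero A X Q \<and>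
    (\<forall>W \<in> Ob A. \<forall>g \<in> Mor A Y W. Comp A X Y W g f = Zero A X W \<longrightarrow>
      (\<exists>!h. h \<in> Mor A Q W \<and> Comp A Y Q W h q = g))"

definition is_mono :: "('o, 'm) preadd \<Rightarrow> 'o \<Rightarrow> 'o \<Rightarrow> 'm \<Rightarrow> bool"
  where "is_mono A X Y f \<longleftrightarrow> f \<in> Mor A X Y \<and>
    (\<forall>W \<in> Ob A. \<forall>g \<in> Mor A W X. \<forall>h \<in> Mor A W X.
      Comp A W X Y f g = Comp A W X Y f h \<longrightarrow> g = h)"

definition is_epi :: "('o, 'm) preadd \<Rightarrow> 'o \<Rightarrow> 'o \<Rightarrow> 'm \<Rightarrow> bool"
  where "is_epi A X Y f \<longleftrightarrow> f \<in> Mor A X Y \<and>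
    (\<forall>W \<in> Ob A. \<forall>g \<in> Mor A Y W. \<forall>h \<in> Mor A Y W.
      Comp A X Y W g f = Comp A X Y W h f \<longrightarrow> g = h)"

locale abelian_category = preadditive_category +
  assumes ex_zero_ob: "\<exists>Z. is_zero_ob A Z"
    and ex_biproduct:
      "\<lbrakk>X \<in> Ob A; Y \<in> Ob A\<rbrakk> \<Longrightarrow> \<exists>B i1 i2 p1 p2. is_biproduct A X Y B i1 i2 p1 p2"
    and ex_kernel:
      "\<lbrakk>X \<in> Ob A; Y \<in> Ob A; f \<in> Mor A X Y\<rbrakk> \<Longrightarrow> \<exists>K k. is_kernel A X Y f K k"
    and ex_cokernel:
      "\<lbrakk>X \<in> Ob A; Y \<in> Ob A; f \<in> Mor A X Y\<rbrakk> \<Longrightarrow> \<exists>Q q. is_cokernel A X Y f Q q"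
    and mono_normal:
      "\<lbrakk>X \<in> Ob A; Y \<in> Ob A; is_mono A X Y f\<rbrakk>
        \<Longrightarrow> \<exists>Z \<in> Ob A. \<exists>g \<in> Mor A Y Z. is_kernel A Y Z g X f"
    and epi_normal:
      "\<lbrakk>X \<in> Ob A; Y \<in> Ob A; is_epi A X Y f\<rbrakk>
        \<Longrightarrow> \<exists>W \<in> Ob A. \<exists>g \<in> Mor A W X. is_cokernel A W X g Y f"

definition is_projective :: "('o, 'm) preadd \<Rightarrow> 'o \<Rightarrow> bool"
  where "is_projective A P \<longleftrightarrow> P \<in> Ob A \<and>
    (\<forall>X \<in> Ob A. \<forall>Y \<in> Ob A. \<forall>g. is_epi A X Y g \<longrightarrow>
      (\<forall>f \<in> Mor A P Y. \<exists>h \<in> Mor A P X. Comp A P X Y g h = f))"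

definition enough_projectives :: "('o, 'm) preadd \<Rightarrow> bool"
  where "enough_projectives A \<longleftrightarrow>
    (\<forall>X \<in> Ob A. \<exists>P p. is_projective A P \<and> is_epi A P X p)"

text \<open>A full additive subcategory closed under isomorphisms, given by its class of objects.\<close>

definition additive_subcategory :: "('o, 'm) preadd \<Rightarrow> 'o set \<Rightarrow> bool"
  where "additive_subcategory A \<X> \<longleftrightarrow>
    \<X> \<subseteq> Ob A \<and>
    (\<forall>X \<in> \<X>. \<forall>Y \<in> Ob A. isomorphic_ob A X Y \<longrightarrow> Y \<in> \<X>) \<and>
    (\<exists>Z \<in> \<X>. is_zero_ob A Z) \<and>
    (\<forall>X \<in> \<X>. \<forall>Y \<in> \<X>. \<forall>B i1 i2 p1 p2. is_biproduct A X Y B i1 i2 p1 p2 \<longrightarrow> B \<in> \<X>)"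


section \<open>Complexes\<close>

record ('o, 'm) cpx =
  cob :: "int \<Rightarrow> 'o"
  cdiff :: "int \<Rightarrow> 'm"

definition is_complex :: "('o, 'm) preadd \<Rightarrow> ('o, 'm) cpx \<Rightarrow> bool"
  where "is_complex A C \<longleftrightarrow>
    (\<forall>i. cob C i \<in> Ob A) \<and>
    (\<forall>i. cdiff C i \<in> Mor A (cob C i) (cob C (i + 1))) \<and>
    (\<forall>i. Comp A (cob C i) (cob C (i + 1)) (cob C (i + 2)) (cdiff C (i + 1)) (cdiff C i)
      = Zero A (cob C i) (cob C (i + 2)))"

definition bounded_complex :: "('o, 'm) preadd \<Rightarrow> ('o, 'm) cpx \<Rightarrow> bool"
  where "bounded_complex A C \<longleftrightarrow> is_complex A C \<and>
    (\<exists>a b. \<forall>i. i < a \<or> b < i \<longrightarrow> is_zero_ob A (cob C i))"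

definition stalk :: "('o, 'm) preadd \<Rightarrow> 'o \<Rightarrow> ('o, 'm) cpx"
  where "stalk A M = (let X = (\<lambda>i. if i = 0 then M else zero_ob A) in
    \<lparr>cob = X, cdiff = (\<lambda>i. Zero A (X i) (X (i + 1)))\<rparr>)"

definition shift :: "('o, 'm) preadd \<Rightarrow> ('o, 'm) cpx \<Rightarrow> int \<Rightarrow> ('o, 'm) cpx"
  where "shift A C n =
    \<lparr>cob = (\<lambda>m. cob C (n + m)),
     cdiff = (\<lambda>m. if even n then cdiff C (n + m)
                  else Neg A (cob C (n + m)) (cob C (n + m + 1)) (cdiff C (n + m)))\<rparr>"

text \<open>
  \<open>H\<close> is the cohomology of \<open>C\<close> in degree \<open>i\<close>: the cokernel of the map \<open>c\<close> that
  \<open>d\<^sup>i\<^sup>-\<^sup>1\<close> induces into the kernel \<open>k : K \<rightarrow> C\<^sup>i\<close> of \<open>d\<^sup>i\<close>.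
\<close>

definition is_cohomology :: "('o, 'm) preadd \<Rightarrow> ('o, 'm) cpx \<Rightarrow> int \<Rightarrow> 'o \<Rightarrow> bool"
  where "is_cohomology A C i H \<longleftrightarrow>
    (\<exists>K k c q. is_kernel A (cob C i) (cob C (i + 1)) (cdiff C i) K k \<and>
      c \<in> Mor A (cob C (i - 1)) K \<and>
      Comp A (cob C (i - 1)) K (cob C i) k c = cdiff C (i - 1) \<and>
      is_cokernel A (cob C (i - 1)) K c H q)"


section \<open>Complexes of abelian groups\<close>

text \<open>
  A complex of abelian groups is a family of groups \<open>G n\<close> with differentials
  \<open>d n\<close> from \<open>G n\<close> to \<open>G (n + 1)\<close>.
\<close>

definition acyclic_groups :: "(int \<Rightarrow> 'm monoid) \<Rightarrow> (int \<Rightarrow> 'm \<Rightarrow> 'm) \<Rightarrow> bool"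
  where "acyclic_groups G d \<longleftrightarrow>
    (\<forall>n. kernel (G n) (G (n + 1)) (d n) = d (n - 1) ` carrier (G (n - 1)))"

definition cohomology_group ::
    "(int \<Rightarrow> 'm monoid) \<Rightarrow> (int \<Rightarrow> 'm \<Rightarrow> 'm) \<Rightarrow> int \<Rightarrow> 'm set monoid"
  where "cohomology_group G d n =
    (G n)\<lparr>carrier := kernel (G n) (G (n + 1)) (d n)\<rparr> Mod (d (n - 1) ` carrier (G (n - 1)))"

definition is_X_acyclic :: "('o, 'm) preadd \<Rightarrow> 'o set \<Rightarrow> ('o, 'm) cpx \<Rightarrow> bool"
  where "is_X_acyclic A \<X> S \<longleftrightarrow>
    (\<forall>X \<in> \<X>. acyclic_groups (\<lambda>n. Hom A X (cob S n))
      (\<lambda>n f. Comp A X (cob S n) (cob S (n + 1)) (cdiff S n) f))"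


section \<open>Proper resolutions and relative cohomology\<close>

definition is_resolution ::
    "('o, 'm) preadd \<Rightarrow> 'o set \<Rightarrow> 'o \<Rightarrow> ('o, 'm) cpx \<Rightarrow> bool"
  where "is_resolution A \<X> M P \<longleftrightarrow> is_complex A P \<and>
    (\<forall>i \<le> 0. cob P i \<in> \<X>) \<and>
    (\<forall>i > 0. is_zero_ob A (cob P i)) \<and>
    (\<forall>i < 0. \<exists>H. is_cohomology A P i H \<and> is_zero_ob A H) \<and>
    (\<exists>H. is_cohomology A P 0 H \<and> isomorphic_ob A H M)"

text \<open>
  The sequence \<open>\<dots> \<rightarrow> P\<^sup>-\<^sup>1 \<rightarrow> P\<^sup>0 \<rightarrow> M \<rightarrow> 0\<close> with augmentation \<open>e\<close>, where \<open>P\<^sup>0\<close> stays in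
  degree 0 and \<open>M\<close> sits in degree 1.
\<close>

definition augmented :: "('o, 'm) preadd \<Rightarrow> ('o, 'm) cpx \<Rightarrow> 'o \<Rightarrow> 'm \<Rightarrow> ('o, 'm) cpx"
  where "augmented A P M e =
    (let X = (\<lambda>i. if i \<le> 0 then cob P i else if i = 1 then M else zero_ob A) in
    \<lparr>cob = X,
     cdiff = (\<lambda>i. if i < 0 then cdiff P i else if i = 0 then e else Zero A (X i) (X (i + 1)))\<rparr>)"

text \<open>
  As \<open>P\<^sup>1 = 0\<close>, an isomorphism of the cohomology in degree 0 with \<open>M\<close> amounts to a cokernel
  \<open>e : P\<^sup>0 \<rightarrow> M\<close> of \<open>d\<^sup>-\<^sup>1\<close>. It is unique up to an automorphism of \<open>M\<close>, so properness does
  not depend on it.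
\<close>

definition is_proper_resolution ::
    "('o, 'm) preadd \<Rightarrow> 'o set \<Rightarrow> 'o \<Rightarrow> ('o, 'm) cpx \<Rightarrow> bool"
  where "is_proper_resolution A \<X> M P \<longleftrightarrow> is_resolution A \<X> M P \<and>
    (\<exists>e. is_cokernel A (cob P (- 1)) (cob P 0) (cdiff P (- 1)) M e \<and>
      is_X_acyclic A \<X> (augmented A P M e))"

text \<open>
  The cohomology in degree \<open>n\<close> of the complex \<open>Hom(P, N)\<close>, which has \<open>Hom(P\<^sup>-\<^sup>n, N)\<close> in
  degree \<open>n\<close>; for a proper resolution \<open>P\<close> of \<open>M\<close> this is the relative Ext group of
  \<open>M\<close> and \<open>N\<close>. A sign in the differential would change neither kernels nor images.
\<close>

definition rel_Ext :: "('o, 'm) preadd \<Rightarrow> ('o, 'm) cpx \<Rightarrow> 'o \<Rightarrow> int \<Rightarrow> 'm set monoid"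
  where "rel_Ext A P N n = cohomology_group (\<lambda>k. Hom A (cob P (- k)) N)
    (\<lambda>k f. Comp A (cob P (- k - 1)) (cob P (- k)) N f (cdiff P (- k - 1))) n"


section \<open>The bounded homotopy category\<close>

definition chain_map_group ::
    "('o, 'm) preadd \<Rightarrow> ('o, 'm) cpx \<Rightarrow> ('o, 'm) cpx \<Rightarrow> (int \<Rightarrow> 'm) monoid"
  where "chain_map_group A C D =
    \<lparr>carrier = {f. \<forall>i. f i \<in> Mor A (cob C i) (cob D i) \<and>
        Comp A (cob C i) (cob D i) (cob D (i + 1)) (cdiff D i) (f i)
        = Comp A (cob C i) (cob C (i + 1)) (cob D (i + 1)) (f (i + 1)) (cdiff C i)},
     mult = (\<lambda>f g i. Add A (cob C i) (cob D i) (f i) (g i)),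
     one = (\<lambda>i. Zero A (cob C i) (cob D i))\<rparr>"

definition null_homotopic ::
    "('o, 'm) preadd \<Rightarrow> ('o, 'm) cpx \<Rightarrow> ('o, 'm) cpx \<Rightarrow> (int \<Rightarrow> 'm) set"
  where "null_homotopic A C D =
    {f \<in> carrier (chain_map_group A C D).
      \<exists>s. \<forall>i. s i \<in> Mor A (cob C i) (cob D (i - 1)) \<and>
        f i = Add A (cob C i) (cob D i)
          (Comp A (cob C i) (cob D (i - 1)) (cob D i) (cdiff D (i - 1)) (s i))
          (Comp A (cob C i) (cob C (i + 1)) (cob D i) (s (i + 1)) (cdiff C i))}"

definition homotopy_class ::
    "('o, 'm) preadd \<Rightarrow> ('o, 'm) cpx \<Rightarrow> ('o, 'm) cpx \<Rightarrow> (int \<Rightarrow> 'm) \<Rightarrow> (int \<Rightarrow> 'm) set"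
  where "homotopy_class A C D f = null_homotopic A C D #>\<^bsub>chain_map_group A C D\<^esub> f"

text \<open>The union in the composition is over equal sets.\<close>

definition Kb :: "('o, 'm) preadd \<Rightarrow> (('o, 'm) cpx, (int \<Rightarrow> 'm) set) preadd"
  where "Kb A =
    \<lparr>Ob = {C. bounded_complex A C},
     Hom = (\<lambda>C D. chain_map_group A C D Mod null_homotopic A C D),
     Ident = (\<lambda>C. homotopy_class A C C (\<lambda>i. Ident A (cob C i))),
     Comp = (\<lambda>C D E G F. \<Union>g \<in> G. \<Union>f \<in> F.
       homotopy_class A C E (\<lambda>i. Comp A (cob C i) (cob D i) (cob E i) (g i) (f i)))\<rparr>"

definition Kb_acyclic :: "('o, 'm) preadd \<Rightarrow> 'o set \<Rightarrow> ('o, 'm) cpx set"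
  where "Kb_acyclic A \<X> = {C \<in> Ob (Kb A). is_X_acyclic A \<X> C}"

text \<open>
  \<open>E\<close> is a mapping cone of the chain map \<open>f : C \<rightarrow> D\<close>: in degree \<open>i\<close> it is a biproduct of
  \<open>C\<^sup>i\<^sup>+\<^sup>1\<close> and \<open>D\<^sup>i\<close>, with differential \<open>(x, y) \<mapsto> (- d x, f x + d y)\<close>.
\<close>

definition is_cone ::
    "('o, 'm) preadd \<Rightarrow> ('o, 'm) cpx \<Rightarrow> ('o, 'm) cpx \<Rightarrow> (int \<Rightarrow> 'm) \<Rightarrow> ('o, 'm) cpx \<Rightarrow> bool"
  where "is_cone A C D f E \<longleftrightarrow>
    (\<exists>i1 i2 p1 p2.
      (\<forall>i. is_biproduct A (cob C (i + 1)) (cob D i) (cob E i) (i1 i) (i2 i) (p1 i) (p2 i)) \<and>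
      (\<forall>i. cdiff E i =
        Add A (cob E i) (cob E (i + 1))
          (Comp A (cob E i) (cob C (i + 1)) (cob E (i + 1))
            (Add A (cob C (i + 1)) (cob E (i + 1))
              (Comp A (cob C (i + 1)) (cob C (i + 2)) (cob E (i + 1)) (i1 (i + 1))
                (Neg A (cob C (i + 1)) (cob C (i + 2)) (cdiff C (i + 1))))
              (Comp A (cob C (i + 1)) (cob D (i + 1)) (cob E (i + 1)) (i2 (i + 1)) (f (i + 1))))
            (p1 i))
          (Comp A (cob E i) (cob D i) (cob E (i + 1))
            (Comp A (cob D i) (cob D (i + 1)) (cob E (i + 1)) (i2 (i + 1)) (cdiff D i))
            (p2 i))))"


section \<open>Verdier quotients\<close>

text \<open>
  Localization of a preadditive category \<open>K\<close> by a calculus of fractions, where \<open>S X Y\<close> is the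
  set of morphisms from \<open>X\<close> to \<open>Y\<close> to be inverted. A roof \<open>(Z, s, f)\<close> from \<open>X\<close> to \<open>Y\<close>
  represents the fraction \<open>f s\<^sup>-\<^sup>1\<close>.
\<close>

definition roofs ::
    "('o, 'm) preadd \<Rightarrow> ('o \<Rightarrow> 'o \<Rightarrow> 'm set) \<Rightarrow> 'o \<Rightarrow> 'o \<Rightarrow> ('o \<times> 'm \<times> 'm) set"
  where "roofs K S X Y = {(Z, s, f). Z \<in> Ob K \<and> s \<in> S Z X \<and> f \<in> Mor K Z Y}"

definition roof_rel ::
    "('o, 'm) preadd \<Rightarrow> ('o \<Rightarrow> 'o \<Rightarrow> 'm set) \<Rightarrow> 'o \<Rightarrow> 'o \<Rightarrow>
      (('o \<times> 'm \<times> 'm) \<times> ('o \<times> 'm \<times> 'm)) set"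
  where "roof_rel K S X Y =
    {((Z, s, f), (Z', s', f')).
      (Z, s, f) \<in> roofs K S X Y \<and> (Z', s', f') \<in> roofs K S X Y \<and>
      (\<exists>W \<in> Ob K. \<exists>u \<in> Mor K W Z. \<exists>u' \<in> Mor K W Z'.
        Comp K W Z X s u = Comp K W Z' X s' u' \<and> Comp K W Z X s u \<in> S W X \<and>
        Comp K W Z Y f u = Comp K W Z' Y f' u')}"

definition fraction ::
    "('o, 'm) preadd \<Rightarrow> ('o \<Rightarrow> 'o \<Rightarrow> 'm set) \<Rightarrow> 'o \<Rightarrow> 'o \<Rightarrow> ('o \<times> 'm \<times> 'm) \<Rightarrow> ('o \<times> 'm \<times> 'm) set"
  where "fraction K S X Y r = roof_rel K S X Y `` {r}"

text \<open>
  Fractions are added by means of a common denominator, \<open>f s\<^sup>-\<^sup>1 + g s\<^sup>-\<^sup>1 = (f + g) s\<^sup>-\<^sup>1\<close>, and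
  composed by means of an Ore square \<open>f u = t v\<close>, \<open>(g t\<^sup>-\<^sup>1) (f s\<^sup>-\<^sup>1) = (g v) (s u)\<^sup>-\<^sup>1\<close>. When
  \<open>S\<close> admits a calculus of fractions, the unions below are over equal sets.
\<close>

definition localization ::
    "('o, 'm) preadd \<Rightarrow> ('o \<Rightarrow> 'o \<Rightarrow> 'm set) \<Rightarrow> ('o, ('o \<times> 'm \<times> 'm) set) preadd"
  where "localization K S =
    \<lparr>Ob = Ob K,
     Hom = (\<lambda>X Y.
       \<lparr>carrier = roofs K S X Y // roof_rel K S X Y,
        mult = (\<lambda>p q. \<Union>{fraction K S X Y (Z, s, Add K Z Y f g) | Z s f g.
          (Z, s, f) \<in> p \<and> (Z, s, g) \<in> q}),
        one = fraction K S X Y (X, Ident K X, Zero K X Y)\<rparr>),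
     Ident = (\<lambda>X. fraction K S X X (X, Ident K X, Ident K X)),
     Comp = (\<lambda>X Y Z q p.
       \<Union>{fraction K S X Z (W, Comp K W U X s u, Comp K W V Z g v) | U s f V t g W u v.
         (U, s, f) \<in> p \<and> (V, t, g) \<in> q \<and> W \<in> Ob K \<and> u \<in> S W U \<and> v \<in> Mor K W V \<and>
         Comp K W U Y f u = Comp K W V Y t v})\<rparr>"

text \<open>
  The Verdier quotient by a triangulated subcategory inverts the morphisms that fit into a
  distinguished triangle whose third object lies in the subcategory. In the homotopy category every
  distinguished triangle on a morphism is isomorphic to the one given by the mapping cone of any
  representing chain map, and acyclicity is invariant under isomorphism in the homotopy category.
\<close>

definition Kb_denominators ::
    "('o, 'm) preadd \<Rightarrow> 'o set \<Rightarrow> ('o, 'm) cpx \<Rightarrow> ('o, 'm) cpx \<Rightarrow> (int \<Rightarrow> 'm) set set"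
  where "Kb_denominators A \<X> C D =
    {F \<in> Mor (Kb A) C D. \<exists>f \<in> F. \<exists>E \<in> Kb_acyclic A \<X>. is_cone A C D f E}"

definition Db ::
    "('o, 'm) preadd \<Rightarrow> 'o set \<Rightarrow>
      (('o, 'm) cpx, (('o, 'm) cpx \<times> (int \<Rightarrow> 'm) set \<times> (int \<Rightarrow> 'm) set) set) preadd"
  where "Db A \<X> = localization (Kb A) (Kb_denominators A \<X>)"

end

theory Submission
  imports Defs
begin

text \<open>
  Let \<open>\<epsilon> : P \<rightarrow> M\<close> be the augmentation of the proper resolution. The group \<open>Ext\<^sup>n(M, N)\<close> consists of the
  homotopy classes of chain maps \<open>P \<rightarrow> N[n]\<close> (\<open>rel_Ext_iso\<close>), so it has to be shown that, for bounded \<open>Y\<close>,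
  morphisms \<open>M \<rightarrow> Y\<close> in the Verdier quotient are the same as homotopy classes of maps \<open>P \<rightarrow> Y\<close>
  (\<open>Hom_Db_iso\<close>). If \<open>P\<close> were bounded, this would be immediate: \<open>\<epsilon>\<close> becomes invertible in the quotient,
  and maps out of \<open>P\<close> do not see acyclic complexes.

  In general a fraction \<open>f s\<^sup>-\<^sup>1\<close> with denominator \<open>s : Z \<rightarrow> M\<close> is sent to \<open>f l\<close>, where \<open>l : P \<rightarrow> Z\<close> is the
  lift of \<open>\<epsilon>\<close> along \<open>s\<close>. The lift exists and is unique up to homotopy by the comparison theorem, since
  \<open>P\<close> consists of objects of \<open>\<X>\<close> and is bounded above (\<open>lift_exists\<close>, \<open>lift_unique\<close>). To go back, \<open>P\<close> is
  replaced by a canonical truncation \<open>W\<close>, which ends with a kernel in degree \<open>j\<close>. As \<open>Hom(X, _)\<close> preserves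
  kernels, \<open>W \<rightarrow> M\<close> is again a denominator (\<open>w_resolves\<close>), and if \<open>j\<close> is small enough with respect to a
  bounded complex \<open>Y\<close>, then \<open>P\<close> and \<open>W\<close> have the same homotopy classes of maps to \<open>Y\<close> (\<open>factor_bij\<close>).
  These two properties of \<open>P\<close>, unique lifts along denominators and approximation by denominators, imply
  the bijection formally, in any preadditive category (\<open>Hom_localization_iso\<close>).

  Denominators with target \<open>M\<close> are handled without their cones: a cone of \<open>s : Z \<rightarrow> M\<close> is acyclic under
  \<open>Hom(X, _)\<close> iff \<open>Hom(X, s)\<close> induces a bijection in cohomology (\<open>cone_acyclic_iff\<close>).
\<close>

section \<open>Calculus in preadditive categories\<close>

context preadditive_category
begin

lemma Hom_is_group: "\<lbrakk>X \<in> Ob A; Y \<in> Ob A\<rbrakk> \<Longrightarrow> group (Hom A X Y)"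
  using Hom_group comm_group_def by blast

lemma Zero_closed [simp]: "\<lbrakk>X \<in> Ob A; Y \<in> Ob A\<rbrakk> \<Longrightarrow> Zero A X Y \<in> Mor A X Y"
  by (simp add: Hom_is_group group.is_monoid monoid.one_closed)

lemma Add_closed [simp]:
  "\<lbrakk>X \<in> Ob A; Y \<in> Ob A; f \<in> Mor A X Y; g \<in> Mor A X Y\<rbrakk> \<Longrightarrow> Add A X Y f g \<in> Mor A X Y"
  by (simp add: Hom_is_group group.is_monoid monoid.m_closed)

lemma Neg_closed [simp]:
  "\<lbrakk>X \<in> Ob A; Y \<in> Ob A; f \<in> Mor A X Y\<rbrakk> \<Longrightarrow> Neg A X Y f \<in> Mor A X Y"
  by (simp add: Hom_is_group group.inv_closed)

lemmas [simp] = Ident_closed Comp_closed Comp_Ident_left Comp_Ident_right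

lemma Add_assoc:
  "\<lbrakk>X \<in> Ob A; Y \<in> Ob A; f \<in> Mor A X Y; g \<in> Mor A X Y; h \<in> Mor A X Y\<rbrakk>
    \<Longrightarrow> Add A X Y (Add A X Y f g) h = Add A X Y f (Add A X Y g h)"
  by (simp add: Hom_is_group group.is_monoid monoid.m_assoc)

lemma Add_commute:
  "\<lbrakk>X \<in> Ob A; Y \<in> Ob A; f \<in> Mor A X Y; g \<in> Mor A X Y\<rbrakk> \<Longrightarrow> Add A X Y f g = Add A X Y g f"
  by (meson Hom_group comm_group_def comm_monoid.m_comm)

lemma Add_left_commute:
  "\<lbrakk>X \<in> Ob A; Y \<in> Ob A; f \<in> Mor A X Y; g \<in> Mor A X Y; h \<in> Mor A X Y\<rbrakk>
    \<Longrightarrow> Add A X Y f (Add A X Y g h) = Add A X Y g (Add A X Y f h)"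
  by (metis Add_assoc Add_commute)

lemmas Add_ac = Add_assoc Add_commute Add_left_commute

lemma Add_Zero_left [simp]:
  "\<lbrakk>X \<in> Ob A; Y \<in> Ob A; f \<in> Mor A X Y\<rbrakk> \<Longrightarrow> Add A X Y (Zero A X Y) f = f"
  by (simp add: Hom_is_group group.is_monoid monoid.l_one)

lemma Add_Zero_right [simp]:
  "\<lbrakk>X \<in> Ob A; Y \<in> Ob A; f \<in> Mor A X Y\<rbrakk> \<Longrightarrow> Add A X Y f (Zero A X Y) = f"
  by (simp add: Hom_is_group group.is_monoid monoid.r_one)

lemma Add_Neg_left [simp]:
  "\<lbrakk>X \<in> Ob A; Y \<in> Ob A; f \<in> Mor A X Y\<rbrakk> \<Longrightarrow> Add A X Y (Neg A X Y f) f = Zero A X Y"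
  by (simp add: Hom_is_group group.l_inv)

lemma Add_Neg_right [simp]:
  "\<lbrakk>X \<in> Ob A; Y \<in> Ob A; f \<in> Mor A X Y\<rbrakk> \<Longrightarrow> Add A X Y f (Neg A X Y f) = Zero A X Y"
  by (simp add: Hom_is_group group.r_inv)

lemma Neg_Neg [simp]:
  "\<lbrakk>X \<in> Ob A; Y \<in> Ob A; f \<in> Mor A X Y\<rbrakk> \<Longrightarrow> Neg A X Y (Neg A X Y f) = f"
  by (simp add: Hom_is_group group.inv_inv)

lemma Add_cancel:
  "\<lbrakk>X \<in> Ob A; Y \<in> Ob A; f \<in> Mor A X Y; g \<in> Mor A X Y; h \<in> Mor A X Y;
    Add A X Y f g = Add A X Y f h\<rbrakk> \<Longrightarrow> g = h"
  using Add_assoc[of X Y "Neg A X Y f" f g] Add_assoc[of X Y "Neg A X Y f" f h] by simp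

lemma Neg_unique:
  "\<lbrakk>X \<in> Ob A; Y \<in> Ob A; f \<in> Mor A X Y; g \<in> Mor A X Y; Add A X Y f g = Zero A X Y\<rbrakk>
    \<Longrightarrow> g = Neg A X Y f"
  by (metis Add_Neg_right Add_cancel Neg_closed)

lemma Neg_Zero [simp]: "\<lbrakk>X \<in> Ob A; Y \<in> Ob A\<rbrakk> \<Longrightarrow> Neg A X Y (Zero A X Y) = Zero A X Y"
  by (metis Neg_unique Add_Zero_left Zero_closed)

lemma Comp_Zero_left [simp]:
  assumes "X \<in> Ob A" "Y \<in> Ob A" "Z \<in> Ob A" "f \<in> Mor A X Y"
  shows "Comp A X Y Z (Zero A Y Z) f = Zero A X Z"
proof -
  let ?z = "Comp A X Y Z (Zero A Y Z) f"
  have "Add A X Z ?z ?z = Add A X Z ?z (Zero A X Z)"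
    using Comp_Add_left[of X Y Z f "Zero A Y Z" "Zero A Y Z", symmetric] assms by simp
  with assms show ?thesis by (metis Add_cancel Comp_closed Zero_closed)
qed

lemma Comp_Zero_right [simp]:
  assumes "X \<in> Ob A" "Y \<in> Ob A" "Z \<in> Ob A" "g \<in> Mor A Y Z"
  shows "Comp A X Y Z g (Zero A X Y) = Zero A X Z"
proof -
  let ?z = "Comp A X Y Z g (Zero A X Y)"
  have "Add A X Z ?z ?z = Add A X Z ?z (Zero A X Z)"
    using Comp_Add_right[of X Y Z "Zero A X Y" "Zero A X Y" g, symmetric] assms by simp
  with assms show ?thesis by (metis Add_cancel Comp_closed Zero_closed)
qed

lemma Comp_Neg_left:
  assumes "X \<in> Ob A" "Y \<in> Ob A" "Z \<in> Ob A" "f \<in> Mor A X Y" "g \<in> Mor A Y Z"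
  shows "Comp A X Y Z (Neg A Y Z g) f = Neg A X Z (Comp A X Y Z g f)"
  using Comp_Add_left[of X Y Z f g "Neg A Y Z g", symmetric] assms by - (rule Neg_unique, simp_all)

lemma Comp_Neg_right:
  assumes "X \<in> Ob A" "Y \<in> Ob A" "Z \<in> Ob A" "f \<in> Mor A X Y" "g \<in> Mor A Y Z"
  shows "Comp A X Y Z g (Neg A X Y f) = Neg A X Z (Comp A X Y Z g f)"
  using Comp_Add_right[of X Y Z f "Neg A X Y f" g, symmetric] assms by - (rule Neg_unique, simp_all)

lemma Neg_Add:
  assumes "X \<in> Ob A" "Y \<in> Ob A" "f \<in> Mor A X Y" "g \<in> Mor A X Y"
  shows "Neg A X Y (Add A X Y f g) = Add A X Y (Neg A X Y f) (Neg A X Y g)"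
  using assms comm_group.inv_mult[OF Hom_group] by metis

lemma Add_Neg_cancel_left:
  assumes "X \<in> Ob A" "Y \<in> Ob A" "f \<in> Mor A X Y" "g \<in> Mor A X Y"
  shows "Add A X Y f (Add A X Y (Neg A X Y f) g) = g"
    and "Add A X Y (Neg A X Y f) (Add A X Y f g) = g"
  using assms by (simp_all flip: Add_assoc)

lemmas add_simps = Comp_Add_left Comp_Add_right Comp_Neg_left Comp_Neg_right Neg_Add
  Add_ac Add_Neg_cancel_left

lemma zero_ob_Ob: "is_zero_ob A Z \<Longrightarrow> Z \<in> Ob A"
  by (simp add: is_zero_ob_def)

lemma to_zero_ob:
  "\<lbrakk>is_zero_ob A Z; X \<in> Ob A; f \<in> Mor A X Z; g \<in> Mor A X Z\<rbrakk> \<Longrightarrow> f = g"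
  by (auto simp: is_zero_ob_def)

lemma from_zero_ob:
  "\<lbrakk>is_zero_ob A Z; X \<in> Ob A; f \<in> Mor A Z X; g \<in> Mor A Z X\<rbrakk> \<Longrightarrow> f = g"
  by (auto simp: is_zero_ob_def)

lemma zero_obI:
  assumes "Z \<in> Ob A" and "Ident A Z = Zero A Z Z"
  shows "is_zero_ob A Z"
proof -
  have "f = Zero A X Z" if "X \<in> Ob A" "f \<in> Mor A X Z" for X f
    using Comp_Ident_left[of X Z f] Comp_Zero_left[of X Z Z f] that assms by simp
  moreover have "f = Zero A Z X" if "X \<in> Ob A" "f \<in> Mor A Z X" for X f
    using Comp_Ident_right[of Z X f] Comp_Zero_right[of Z Z X f] that assms by simp
  ultimately show ?thesis
    using assms(1) unfolding is_zero_ob_def by (metis Zero_closed)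
qed


section \<open>Biproducts\<close>

lemma biproduct_mem:
  assumes "is_biproduct A X Y B i1 i2 p1 p2"
  shows "B \<in> Ob A" "i1 \<in> Mor A X B" "i2 \<in> Mor A Y B" "p1 \<in> Mor A B X" "p2 \<in> Mor A B Y"
  using assms by (simp_all add: is_biproduct_def)

lemma biproduct_decompose:
  assumes bp: "is_biproduct A X Y B i1 i2 p1 p2"
    and "X \<in> Ob A" "Y \<in> Ob A" "W \<in> Ob A" "x \<in> Mor A W B"
  shows "x = Add A W B (Comp A W X B i1 (Comp A W B X p1 x)) (Comp A W Y B i2 (Comp A W B Y p2 x))"
proof -
  note [simp] = biproduct_mem[OF bp] assms(2-)
  have "x = Comp A W B B (Add A B B (Comp A B X B i1 p1) (Comp A B Y B i2 p2)) x"
    using bp by (simp add: is_biproduct_def)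
  also have "\<dots> = Add A W B (Comp A W X B i1 (Comp A W B X p1 x)) (Comp A W Y B i2 (Comp A W B Y p2 x))"
    by (simp add: Comp_Add_left Comp_assoc)
  finally show ?thesis .
qed

lemma biproduct_proj:
  assumes bp: "is_biproduct A X Y B i1 i2 p1 p2"
    and "X \<in> Ob A" "Y \<in> Ob A" "W \<in> Ob A" "a \<in> Mor A W X" "b \<in> Mor A W Y"
  shows "Comp A W B X p1 (Add A W B (Comp A W X B i1 a) (Comp A W Y B i2 b)) = a"
    and "Comp A W B Y p2 (Add A W B (Comp A W X B i1 a) (Comp A W Y B i2 b)) = b"
proof -
  note [simp] = biproduct_mem[OF bp] assms(2-)
  have eqs: "Comp A X B X p1 i1 = Ident A X" "Comp A Y B Y p2 i2 = Ident A Y"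
    "Comp A X B Y p2 i1 = Zero A X Y" "Comp A Y B X p1 i2 = Zero A Y X"
    using bp by (simp_all add: is_biproduct_def)
  show "Comp A W B X p1 (Add A W B (Comp A W X B i1 a) (Comp A W Y B i2 b)) = a"
    by (simp add: Comp_Add_right flip: Comp_assoc) (simp add: eqs)
  show "Comp A W B Y p2 (Add A W B (Comp A W X B i1 a) (Comp A W Y B i2 b)) = b"
    by (simp add: Comp_Add_right flip: Comp_assoc) (simp add: eqs)
qed

lemma biproduct_zero_ob:
  assumes bp: "is_biproduct A X Y B i1 i2 p1 p2" and X: "is_zero_ob A X" and Y: "is_zero_ob A Y"
  shows "is_zero_ob A B"
proof (rule zero_obI)
  note [simp] = biproduct_mem[OF bp] zero_ob_Ob[OF X] zero_ob_Ob[OF Y]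
  show "B \<in> Ob A" by simp
  have "p1 = Zero A B X" "p2 = Zero A B Y"
    using to_zero_ob[OF X, of B] to_zero_ob[OF Y, of B] by simp_all
  moreover have "Ident A B = Add A B B (Comp A B X B i1 p1) (Comp A B Y B i2 p2)"
    using bp by (simp add: is_biproduct_def)
  ultimately show "Ident A B = Zero A B B" by simp
qed


section \<open>Chain maps and homotopy\<close>

lemma complex_mem [simp]: "is_complex A C \<Longrightarrow> cob C i \<in> Ob A"
  by (simp add: is_complex_def)

lemma cdiff_mem [simp]: "\<lbrakk>is_complex A C; j = i + 1\<rbrakk> \<Longrightarrow> cdiff C i \<in> Mor A (cob C i) (cob C j)"
  by (simp add: is_complex_def)

lemma cdiff_cdiff [simp]:
  assumes "is_complex A C" "j = i + 1" "k = j + 1"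
  shows "Comp A (cob C i) (cob C j) (cob C k) (cdiff C j) (cdiff C i) = Zero A (cob C i) (cob C k)"
proof -
  have "k = i + 2" using assms by simp
  then show ?thesis using assms(1) unfolding is_complex_def assms(2) by blast
qed

lemma cdiff_cdiff_post [simp]:
  assumes "is_complex A C" "j = i + 1" "k = j + 1" "X \<in> Ob A" "x \<in> Mor A X (cob C i)"
  shows "Comp A X (cob C j) (cob C k) (cdiff C j) (Comp A X (cob C i) (cob C j) (cdiff C i) x)
    = Zero A X (cob C k)"
  using assms by (simp flip: Comp_assoc)

lemma cdiff_cdiff_pre [simp]:
  assumes "is_complex A C" "j = i + 1" "k = j + 1" "X \<in> Ob A" "x \<in> Mor A (cob C k) X"
  shows "Comp A (cob C i) (cob C j) X (Comp A (cob C j) (cob C k) X x (cdiff C j)) (cdiff C i)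
    = Zero A (cob C i) X"
  using assms by (simp add: Comp_assoc)

definition chain_map :: "('o, 'm) cpx \<Rightarrow> ('o, 'm) cpx \<Rightarrow> (int \<Rightarrow> 'm) \<Rightarrow> bool"
  where "chain_map C D f \<longleftrightarrow> f \<in> carrier (chain_map_group A C D)"

lemma chain_map_iff: "chain_map C D f \<longleftrightarrow> (\<forall>i. f i \<in> Mor A (cob C i) (cob D i) \<and>
        Comp A (cob C i) (cob D i) (cob D (i + 1)) (cdiff D i) (f i)
        = Comp A (cob C i) (cob C (i + 1)) (cob D (i + 1)) (f (i + 1)) (cdiff C i))"
  by (simp add: chain_map_def chain_map_group_def)

lemma chain_map_mem [simp]: "chain_map C D f \<Longrightarrow> f i \<in> Mor A (cob C i) (cob D i)"
  by (simp add: chain_map_iff)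

lemma chain_map_commute:
  "\<lbrakk>chain_map C D f; j = i + 1\<rbrakk> \<Longrightarrow> Comp A (cob C i) (cob D i) (cob D j) (cdiff D i) (f i)
        = Comp A (cob C i) (cob C j) (cob D j) (f j) (cdiff C i)"
  by (simp add: chain_map_iff)

definition comp_map where
  "comp_map C D E g f = (\<lambda>i. Comp A (cob C i) (cob D i) (cob E i) (g i) (f i))"

lemma comp_map_chain_map:
  assumes [simp]: "is_complex A C" "is_complex A D" "is_complex A E" "chain_map C D f" "chain_map D E g"
  shows "chain_map C E (comp_map C D E g f)"
  unfolding chain_map_iff comp_map_def
proof (intro allI conjI)
  fix i
  show "Comp A (cob C i) (cob D i) (cob E i) (g i) (f i) \<in> Mor A (cob C i) (cob E i)"
    by simp
  have "Comp A (cob C i) (cob E i) (cob E (i + 1)) (cdiff E i)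
      (Comp A (cob C i) (cob D i) (cob E i) (g i) (f i)) =
     Comp A (cob C i) (cob D i) (cob E (i + 1)) (Comp A (cob D i) (cob D (i+1)) (cob E (i+1)) (g (i+1)) (cdiff D i)) (f i)"
    by (simp add: chain_map_commute flip: Comp_assoc)
  also have "\<dots> = Comp A (cob C i) (cob D (i + 1)) (cob E (i + 1)) (g (i+1))
      (Comp A (cob C i) (cob C (i+1)) (cob D (i+1)) (f (i+1)) (cdiff C i))"
    by (simp add: chain_map_commute Comp_assoc)
  also have "\<dots> = Comp A (cob C i) (cob C (i + 1)) (cob E (i + 1))
            (Comp A (cob C (i + 1)) (cob D (i + 1)) (cob E (i + 1)) (g (i + 1)) (f (i + 1)))
            (cdiff C i)"
    by (simp add: Comp_assoc)
  finally show "Comp A (cob C i) (cob E i) (cob E (i + 1)) (cdiff E i)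
          (Comp A (cob C i) (cob D i) (cob E i) (g i) (f i)) =
         Comp A (cob C i) (cob C (i + 1)) (cob E (i + 1))
          (Comp A (cob C (i + 1)) (cob D (i + 1)) (cob E (i + 1)) (g (i + 1)) (f (i + 1))) (cdiff C i)" .
qed

lemma chain_map_comm_group:
  assumes [simp]: "is_complex A C" "is_complex A D"
  shows "comm_group (chain_map_group A C D)"
proof (rule comm_groupI)
  show "x \<otimes>\<^bsub>chain_map_group A C D\<^esub> y \<in> carrier (chain_map_group A C D)"
    if "x \<in> carrier (chain_map_group A C D)" "y \<in> carrier (chain_map_group A C D)" for x y
    using that by (auto simp: chain_map_group_def Comp_Add_left Comp_Add_right)
  show "\<exists>y\<in>carrier (chain_map_group A C D).
          y \<otimes>\<^bsub>chain_map_group A C D\<^esub> x = \<one>\<^bsub>chain_map_group A C D\<^esub>"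
    if "x \<in> carrier (chain_map_group A C D)" for x
    by (rule bexI[of _ "\<lambda>i. Neg A (cob C i) (cob D i) (x i)"])
      (use that in \<open>auto simp: chain_map_group_def Comp_Neg_left Comp_Neg_right\<close>)
qed (auto simp: chain_map_group_def Add_ac)

definition htpy_family where
  "htpy_family C D s \<longleftrightarrow> (\<forall>i. s i \<in> Mor A (cob C i) (cob D (i - 1)))"

text \<open>
  The boundary of \<open>s\<close> in the total Hom complex, so that the null-homotopic maps are the boundaries.
\<close>

definition htpy where
  "htpy C D s = (\<lambda>i. Add A (cob C i) (cob D i)
    (Comp A (cob C i) (cob D (i - 1)) (cob D i) (cdiff D (i - 1)) (s i))
    (Comp A (cob C i) (cob C (i + 1)) (cob D i) (s (i + 1)) (cdiff C i)))"

lemma htpy_family_mem [simp]: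
  "\<lbrakk>htpy_family C D s; j = i - 1\<rbrakk> \<Longrightarrow> s i \<in> Mor A (cob C i) (cob D j)"
  by (simp add: htpy_family_def)

lemma htpy_familyI:
  "(\<And>i. s i \<in> Mor A (cob C i) (cob D (i - 1))) \<Longrightarrow> htpy_family C D s"
  by (simp add: htpy_family_def)

lemma null_homotopic_iff:
  "f \<in> null_homotopic A C D \<longleftrightarrow> chain_map C D f \<and> (\<exists>s. htpy_family C D s \<and> f = htpy C D s)"
  by (auto simp: null_homotopic_def chain_map_def htpy_family_def htpy_def fun_eq_iff)

lemma htpy_mem [simp]:
  assumes [simp]: "is_complex A C" "is_complex A D" "htpy_family C D s"
  shows "htpy C D s i \<in> Mor A (cob C i) (cob D i)"
  by (simp add: htpy_def)

lemma htpy_chain_map: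
  assumes [simp]: "is_complex A C" "is_complex A D" "htpy_family C D s"
  shows "chain_map C D (htpy C D s)"
  unfolding chain_map_iff
  by (simp add: htpy_def Comp_Add_left Comp_Add_right) (simp add: Comp_assoc)

lemma htpy_Add:
  assumes [simp]: "is_complex A C" "is_complex A D" "htpy_family C D s" "htpy_family C D t"
  shows "htpy_family C D (\<lambda>i. Add A (cob C i) (cob D (i - 1)) (s i) (t i))"
    and "htpy C D (\<lambda>i. Add A (cob C i) (cob D (i - 1)) (s i) (t i)) i
      = Add A (cob C i) (cob D i) (htpy C D s i) (htpy C D t i)"
  by (auto intro: htpy_familyI simp: htpy_def add_simps)

lemma htpy_Neg:
  assumes [simp]: "is_complex A C" "is_complex A D" "htpy_family C D s"
  shows "htpy_family C D (\<lambda>i. Neg A (cob C i) (cob D (i - 1)) (s i))"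
    and "htpy C D (\<lambda>i. Neg A (cob C i) (cob D (i - 1)) (s i)) i
      = Neg A (cob C i) (cob D i) (htpy C D s i)"
  by (auto intro: htpy_familyI simp: htpy_def add_simps)

lemma htpy_Zero:
  assumes [simp]: "is_complex A C" "is_complex A D"
  shows "htpy_family C D (\<lambda>i. Zero A (cob C i) (cob D (i - 1)))"
    and "htpy C D (\<lambda>i. Zero A (cob C i) (cob D (i - 1))) = (\<lambda>i. Zero A (cob C i) (cob D i))"
  by (auto intro: htpy_familyI simp: htpy_def)

lemma htpy_Comp_left:
  assumes [simp]: "is_complex A C" "is_complex A D" "is_complex A E"
    "htpy_family C D s" "chain_map D E g"
  shows "htpy_family C E (\<lambda>i. Comp A (cob C i) (cob D (i - 1)) (cob E (i - 1)) (g (i - 1)) (s i))"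
    and "htpy C E (\<lambda>i. Comp A (cob C i) (cob D (i - 1)) (cob E (i - 1)) (g (i - 1)) (s i))
      = comp_map C D E g (htpy C D s)"
proof -
  show "htpy_family C E (\<lambda>i. Comp A (cob C i) (cob D (i - 1)) (cob E (i - 1)) (g (i - 1)) (s i))"
    by (rule htpy_familyI) simp
  show "htpy C E (\<lambda>i. Comp A (cob C i) (cob D (i - 1)) (cob E (i - 1)) (g (i - 1)) (s i))
      = comp_map C D E g (htpy C D s)"
  proof
    fix i
    have "Comp A (cob C i) (cob E (i - 1)) (cob E i) (cdiff E (i - 1))
        (Comp A (cob C i) (cob D (i - 1)) (cob E (i - 1)) (g (i - 1)) (s i))
      = Comp A (cob C i) (cob D i) (cob E i) (g i)
        (Comp A (cob C i) (cob D (i - 1)) (cob D i) (cdiff D (i - 1)) (s i))"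
      using chain_map_commute[OF \<open>chain_map D E g\<close>, of i "i - 1"] by (simp flip: Comp_assoc)
    then show "htpy C E (\<lambda>i. Comp A (cob C i) (cob D (i - 1)) (cob E (i - 1)) (g (i - 1)) (s i)) i
      = comp_map C D E g (htpy C D s) i"
      by (simp add: htpy_def comp_map_def Comp_Add_right Comp_assoc)
  qed
qed

lemma htpy_Comp_right:
  assumes [simp]: "is_complex A C" "is_complex A D" "is_complex A E"
    "htpy_family D E s" "chain_map C D f"
  shows "htpy_family C E (\<lambda>i. Comp A (cob C i) (cob D i) (cob E (i - 1)) (s i) (f i))"
    and "htpy C E (\<lambda>i. Comp A (cob C i) (cob D i) (cob E (i - 1)) (s i) (f i))
      = comp_map C D E (htpy D E s) f"
  by (auto intro: htpy_familyI simp: htpy_def comp_map_def fun_eq_iff Comp_Add_left Comp_assoc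
      chain_map_commute)

lemma null_homotopic_normal:
  assumes [simp]: "is_complex A C" "is_complex A D"
  shows "null_homotopic A C D \<lhd> chain_map_group A C D"
proof -
  interpret G: comm_group "chain_map_group A C D" by (rule chain_map_comm_group) simp_all
  have inv: "inv\<^bsub>chain_map_group A C D\<^esub> f = (\<lambda>i. Neg A (cob C i) (cob D i) (f i))"
    if f: "chain_map C D f" for f
  proof (rule G.inv_equality)
    show "f \<in> carrier (chain_map_group A C D)" using f by (simp add: chain_map_def)
    show "(\<lambda>i. Neg A (cob C i) (cob D i) (f i)) \<in> carrier (chain_map_group A C D)"
      using f by (simp add: chain_map_iff Comp_Neg_left Comp_Neg_right flip: chain_map_def)
    show "(\<lambda>i. Neg A (cob C i) (cob D i) (f i)) \<otimes>\<^bsub>chain_map_group A C D\<^esub> f = \<one>\<^bsub>chain_map_group A C D\<^esub>"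
      using f by (simp add: chain_map_group_def)
  qed
  have "subgroup (null_homotopic A C D) (chain_map_group A C D)"
  proof (rule G.subgroupI)
    show "null_homotopic A C D \<subseteq> carrier (chain_map_group A C D)"
      by (auto simp: null_homotopic_def)
    show "null_homotopic A C D \<noteq> {}"
      using htpy_Zero[of C D] htpy_chain_map[of C D] null_homotopic_iff[of _ C D] by fastforce
    fix f g assume "f \<in> null_homotopic A C D" "g \<in> null_homotopic A C D"
    then obtain s t where s: "htpy_family C D s" "f = htpy C D s" and t: "htpy_family C D t" "g = htpy C D t"
      by (auto simp: null_homotopic_iff)
    have "inv\<^bsub>chain_map_group A C D\<^esub> f = htpy C D (\<lambda>i. Neg A (cob C i) (cob D (i - 1)) (s i))"
      unfolding s(2) inv[OF htpy_chain_map[OF assms s(1)]] using s(1) by (simp add: htpy_Neg(2) fun_eq_iff)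
    then show "inv\<^bsub>chain_map_group A C D\<^esub> f \<in> null_homotopic A C D"
      using htpy_Neg(1)[OF _ _ s(1)] htpy_chain_map[OF _ _ htpy_Neg(1)[OF _ _ s(1)]]
      unfolding null_homotopic_iff by auto
    have "f \<otimes>\<^bsub>chain_map_group A C D\<^esub> g = htpy C D (\<lambda>i. Add A (cob C i) (cob D (i - 1)) (s i) (t i))"
      using s t by (simp add: chain_map_group_def htpy_Add(2) fun_eq_iff)
    then show "f \<otimes>\<^bsub>chain_map_group A C D\<^esub> g \<in> null_homotopic A C D"
      using htpy_Add(1)[OF _ _ s(1) t(1)] htpy_chain_map[OF _ _ htpy_Add(1)[OF _ _ s(1) t(1)]]
      unfolding null_homotopic_iff by auto
  qed
  then show ?thesis by (rule G.subgroup_imp_normal)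
qed

lemma mem_homotopy_class_iff:
  assumes [simp]: "is_complex A C" "is_complex A D" and f: "chain_map C D f"
  shows "f' \<in> homotopy_class A C D f \<longleftrightarrow>
    (\<exists>s. htpy_family C D s \<and> f' = (\<lambda>i. Add A (cob C i) (cob D i) (htpy C D s i) (f i)))"
  unfolding homotopy_class_def r_coset_def
  using htpy_chain_map[OF assms(1,2)] by (auto simp: Bex_def null_homotopic_iff chain_map_group_def)

lemma homotopy_class_eq_iff:
  assumes [simp]: "is_complex A C" "is_complex A D" and f: "chain_map C D f" "chain_map C D f'"
  shows "homotopy_class A C D f' = homotopy_class A C D f \<longleftrightarrow> f' \<in> homotopy_class A C D f"
proof -
  interpret N: normal "null_homotopic A C D" "chain_map_group A C D"
    by (rule null_homotopic_normal) simp_all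
  show ?thesis
    using f N.rcos_self[OF _ N.subgroup_axioms] N.repr_independence[OF _ _ N.subgroup_axioms]
    unfolding homotopy_class_def chain_map_def by metis
qed

lemma homotopy_class_self:
  "\<lbrakk>is_complex A C; is_complex A D; chain_map C D f\<rbrakk> \<Longrightarrow> f \<in> homotopy_class A C D f"
  by (simp flip: homotopy_class_eq_iff)

lemma homotopy_class_chain_map:
  assumes "is_complex A C" "is_complex A D" "chain_map C D f" "f' \<in> homotopy_class A C D f"
  shows "chain_map C D f'"
proof -
  interpret N: normal "null_homotopic A C D" "chain_map_group A C D"
    by (rule null_homotopic_normal) (simp_all add: assms)
  show ?thesis
    using N.r_coset_subset_G[OF N.subset, of f] assms(3,4)
    by (auto simp: homotopy_class_def chain_map_def)
qed

lemma Kb_Ob: "Ob (Kb A) = {C. bounded_complex A C}"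
  by (simp add: Kb_def)

lemma bounded_complex_is_complex [simp]: "bounded_complex A C \<Longrightarrow> is_complex A C"
  by (simp add: bounded_complex_def)

lemma Kb_Mor: "Mor (Kb A) C D = homotopy_class A C D ` {f. chain_map C D f}"
  by (simp add: Kb_def carrier_FactGroup homotopy_class_def chain_map_def image_def)

lemma Kb_Mor_obtain:
  assumes "is_complex A C" "is_complex A D" "F \<in> Mor (Kb A) C D" "f \<in> F"
  shows "chain_map C D f" "F = homotopy_class A C D f"
proof -
  obtain g where g: "chain_map C D g" "F = homotopy_class A C D g"
    using assms(3) by (auto simp: Kb_Mor)
  with assms show "chain_map C D f" using homotopy_class_chain_map by blast
  with g assms show "F = homotopy_class A C D f" by (metis homotopy_class_eq_iff)
qed

definition add_map where
  "add_map C D f g = (\<lambda>i. Add A (cob C i) (cob D i) (f i) (g i))"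

lemma add_map_chain_map:
  assumes [simp]: "is_complex A C" "is_complex A D" "chain_map C D f" "chain_map C D g"
  shows "chain_map C D (add_map C D f g)"
  unfolding chain_map_iff add_map_def
  by (simp add: Comp_Add_left Comp_Add_right chain_map_commute)

lemma Kb_Add:
  assumes "is_complex A C" "is_complex A D" "chain_map C D f" "chain_map C D g"
  shows "Add (Kb A) C D (homotopy_class A C D f) (homotopy_class A C D g)
    = homotopy_class A C D (add_map C D f g)"
proof -
  interpret N: normal "null_homotopic A C D" "chain_map_group A C D"
    by (rule null_homotopic_normal) (simp_all add: assms)
  have "f \<otimes>\<^bsub>chain_map_group A C D\<^esub> g = add_map C D f g"
    by (simp add: chain_map_group_def add_map_def)
  then show ?thesis
    using N.rcos_sum[of f g] assms by (simp add: Kb_def homotopy_class_def flip: chain_map_def)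
qed

text \<open>
  If \<open>f' = f + \<partial>s\<close> and \<open>g' = g + \<partial>t\<close>, then \<open>g' f' = g f + \<partial>(g' s + t f)\<close>.
\<close>

lemma comp_map_homotopic:
  assumes [simp]: "is_complex A C" "is_complex A D" "is_complex A E"
    and f [simp]: "chain_map C D f" and g [simp]: "chain_map D E g"
    and f': "f' \<in> homotopy_class A C D f" and g': "g' \<in> homotopy_class A D E g"
  shows "comp_map C D E g' f' \<in> homotopy_class A C E (comp_map C D E g f)"
proof -
  have [simp]: "chain_map C D f'" "chain_map D E g'"
    using homotopy_class_chain_map[OF _ _ f f'] homotopy_class_chain_map[OF _ _ g g'] by simp_all
  obtain s where s [simp]: "htpy_family C D s"
    and f'_eq: "f' = (\<lambda>i. Add A (cob C i) (cob D i) (htpy C D s i) (f i))"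
    using f' by (auto simp: mem_homotopy_class_iff)
  obtain t where t [simp]: "htpy_family D E t"
    and g'_eq: "g' = (\<lambda>i. Add A (cob D i) (cob E i) (htpy D E t i) (g i))"
    using g' by (auto simp: mem_homotopy_class_iff)
  define u where "u = (\<lambda>i. Add A (cob C i) (cob E (i - 1))
    (Comp A (cob C i) (cob D (i - 1)) (cob E (i - 1)) (g' (i - 1)) (s i))
    (Comp A (cob C i) (cob D i) (cob E (i - 1)) (t i) (f i)))"
  have "htpy_family C E u"
    unfolding u_def by (intro htpy_Add(1) htpy_Comp_left(1) htpy_Comp_right(1)) simp_all
  moreover have "comp_map C D E g' f' i
      = Add A (cob C i) (cob E i) (htpy C E u i) (comp_map C D E g f i)" for i
  proof -
    have "htpy C E u i = Add A (cob C i) (cob E i)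
        (comp_map C D E g' (htpy C D s) i) (comp_map C D E (htpy D E t) f i)"
      unfolding u_def
      by (subst htpy_Add(2)) (simp_all add: htpy_Comp_left htpy_Comp_right)
    moreover have "comp_map C D E g' f' i = Add A (cob C i) (cob E i)
        (comp_map C D E g' (htpy C D s) i) (comp_map C D E g' f i)"
      by (simp add: comp_map_def f'_eq Comp_Add_right)
    moreover have "comp_map C D E g' f i = Add A (cob C i) (cob E i)
        (comp_map C D E (htpy D E t) f i) (comp_map C D E g f i)"
      unfolding comp_map_def by (subst g'_eq) (simp add: Comp_Add_left)
    ultimately show ?thesis
      by (simp add: comp_map_def Add_assoc)
  qed
  ultimately show ?thesis
    unfolding mem_homotopy_class_iff[OF assms(1,3) comp_map_chain_map[OF assms(1-5)]] by blast
qed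

lemma Kb_Comp:
  assumes [simp]: "is_complex A C" "is_complex A D" "is_complex A E"
    and f [simp]: "chain_map C D f" and g [simp]: "chain_map D E g"
  shows "Comp (Kb A) C D E (homotopy_class A D E g) (homotopy_class A C D f)
    = homotopy_class A C E (comp_map C D E g f)"
proof -
  let ?F = "homotopy_class A C D f" and ?G = "homotopy_class A D E g"
  have eq: "homotopy_class A C E (comp_map C D E g' f') = homotopy_class A C E (comp_map C D E g f)"
    if "g' \<in> homotopy_class A D E g" "f' \<in> homotopy_class A C D f" for g' f'
    using that comp_map_homotopic[OF assms that(2,1)] homotopy_class_chain_map[of C D f f']
      homotopy_class_chain_map[of D E g g']
    by (simp add: homotopy_class_eq_iff comp_map_chain_map)
  have "f \<in> ?F" "g \<in> ?G"
    by (simp_all add: homotopy_class_self)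
  then have ne: "?F \<noteq> {}" "?G \<noteq> {}" by blast+
  have "Comp (Kb A) C D E ?G ?F = (\<Union>g' \<in> ?G. \<Union>f' \<in> ?F. homotopy_class A C E (comp_map C D E g' f'))"
    by (simp add: Kb_def comp_map_def)
  also have "\<dots> = (\<Union>g' \<in> ?G. \<Union>f' \<in> ?F. homotopy_class A C E (comp_map C D E g f))"
    by (intro SUP_cong refl eq)
  also have "\<dots> = homotopy_class A C E (comp_map C D E g f)"
    by (simp only: UN_constant ne if_False)
  finally show ?thesis .
qed


section \<open>Complexes concentrated in one degree\<close>

text \<open>
  Instead of stalk complexes and their shifts, all arguments use this notion, which leaves the chosen
  zero objects and the signs in a shift out of sight: the differentials vanish in any case.
\<close>

definition concentrated :: "('o, 'm) cpx \<Rightarrow> int \<Rightarrow> bool"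
  where "concentrated T k \<longleftrightarrow> is_complex A T \<and> (\<forall>i. i \<noteq> k \<longrightarrow> is_zero_ob A (cob T i))"

lemma concentrated_complex: "concentrated T k \<Longrightarrow> is_complex A T"
  by (simp add: concentrated_def)

lemma concentrated_bounded: "concentrated T k \<Longrightarrow> bounded_complex A T"
  unfolding concentrated_def bounded_complex_def by (metis less_irrefl)

lemma concentrated_zero: "\<lbrakk>concentrated T k; i \<noteq> k\<rbrakk> \<Longrightarrow> is_zero_ob A (cob T i)"
  by (simp add: concentrated_def)

lemma concentrated_cdiff:
  assumes T: "concentrated T k"
  shows "cdiff T i = Zero A (cob T i) (cob T (i + 1))"
proof (cases "i = k")
  case True
  then show ?thesis
    using to_zero_ob[OF concentrated_zero[OF T, of "i + 1"], of "cob T i"] concentrated_complex[OF T] by simp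
next
  case False
  then show ?thesis
    using from_zero_ob[OF concentrated_zero[OF T, of i], of "cob T (i + 1)"] concentrated_complex[OF T] by simp
qed

lemma chain_map_to_concentrated_ext:
  assumes T: "concentrated T k" and [simp]: "is_complex A C"
    and fg: "chain_map C T f" "chain_map C T g" "f k = g k"
  shows "f = g"
proof
  fix i
  show "f i = g i"
    using to_zero_ob[OF concentrated_zero[OF T, of i], of "cob C i" "f i" "g i"] fg concentrated_complex[OF T]
    by (cases "i = k") simp_all
qed

definition single_map where
  "single_map C T k f = (\<lambda>i. if i = k then f else Zero A (cob C i) (cob T i))"

lemma single_map_chain_map:
  assumes T: "concentrated T k" and [simp]: "is_complex A C"
    and f [simp]: "f \<in> Mor A (cob C k) (cob T k)"
    and fd: "Comp A (cob C (k - 1)) (cob C k) (cob T k) f (cdiff C (k - 1)) = Zero A (cob C (k - 1)) (cob T k)"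
  shows "chain_map C T (single_map C T k f)"
  supply concentrated_complex[OF T, simp] concentrated_cdiff[OF T, simp]
  unfolding chain_map_iff single_map_def
proof (intro allI conjI, goal_cases)
  case (1 i) show ?case by simp
next
  case (2 i)
  have "i = k - 1" if "i + 1 = k" using that by simp
  with T fd show ?case by auto
qed

lemma chain_map_to_concentrated_cdiff:
  assumes T: "concentrated T k" and [simp]: "is_complex A C" and f: "chain_map C T f"
    and "j + 1 = k"
  shows "Comp A (cob C j) (cob C k) (cob T k) (f k) (cdiff C j) = Zero A (cob C j) (cob T k)"
  using chain_map_commute[OF f, of k j] f assms(4) chain_map_mem[OF f, of j]
    concentrated_complex[OF T] concentrated_cdiff[OF T, of j] by simp

text \<open>
  A homotopy into a complex concentrated in degree \<open>k\<close> has only one component that can be nonzero,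
  the one from degree \<open>k + 1\<close> of the source, and this component is subject to no condition.
\<close>

lemma homotopy_class_to_concentrated:
  assumes T: "concentrated T k" and [simp]: "is_complex A C"
    and f [simp]: "chain_map C T f" "chain_map C T f'"
  shows "f' \<in> homotopy_class A C T f \<longleftrightarrow>
    (\<exists>t \<in> Mor A (cob C (k + 1)) (cob T k). f' k = Add A (cob C k) (cob T k)
      (Comp A (cob C k) (cob C (k + 1)) (cob T k) t (cdiff C k)) (f k))" (is "_ \<longleftrightarrow> ?R")
proof -
  note [simp] = concentrated_complex[OF T] concentrated_cdiff[OF T]
  have h: "htpy C T s k = Comp A (cob C k) (cob C (k + 1)) (cob T k) (s (k + 1)) (cdiff C k)"
    if "htpy_family C T s" for s
    using that by (simp add: htpy_def)
  show ?thesis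
  proof
    assume "f' \<in> homotopy_class A C T f"
    then obtain s where s: "htpy_family C T s"
        "f' = (\<lambda>i. Add A (cob C i) (cob T i) (htpy C T s i) (f i))"
      by (auto simp: mem_homotopy_class_iff)
    then show ?R by (intro bexI[of _ "s (k + 1)"]) (simp_all add: h)
  next
    assume ?R
    then obtain t where t: "t \<in> Mor A (cob C (k + 1)) (cob T k)"
      "f' k = Add A (cob C k) (cob T k)
        (Comp A (cob C k) (cob C (k + 1)) (cob T k) t (cdiff C k)) (f k)" ..
    define s where "s = (\<lambda>i. if i = k + 1 then t else Zero A (cob C i) (cob T (i - 1)))"
    have s [simp]: "htpy_family C T s"
      using t by (simp add: htpy_family_def s_def)
    have "f' = add_map C T (htpy C T s) f"
    proof (rule chain_map_to_concentrated_ext[OF T])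
      show "chain_map C T (add_map C T (htpy C T s) f)"
        by (simp add: add_map_chain_map htpy_chain_map)
      show "f' k = add_map C T (htpy C T s) f k"
        using t by (simp add: add_map_def h) (simp add: s_def)
    qed simp_all
    then show "f' \<in> homotopy_class A C T f"
      unfolding mem_homotopy_class_iff[OF \<open>is_complex A C\<close> concentrated_complex[OF T] f(1)] add_map_def
      using s by blast
  qed
qed

end

section \<open>Acyclic mapping cones\<close>

context preadditive_category
begin

text \<open>
  Objects are indexed by integer terms, so equal indices have to reach the same normal form.
\<close>

lemma index_arith [simp]: "i + 1 + 1 = i + (2 :: int)" "i - 1 + 2 = i + (1 :: int)"
  by simp_all

lemma X_acyclic_iff:
  assumes S: "is_complex A S" and X: "\<X> \<subseteq> Ob A"
  shows "is_X_acyclic A \<X> S \<longleftrightarrow> (\<forall>X \<in> \<X>. \<forall>i. \<forall>x \<in> Mor A X (cob S i).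
    Comp A X (cob S i) (cob S (i + 1)) (cdiff S i) x = Zero A X (cob S (i + 1)) \<longrightarrow>
    (\<exists>y \<in> Mor A X (cob S (i - 1)). Comp A X (cob S (i - 1)) (cob S i) (cdiff S (i - 1)) y = x))"
proof -
  have "(kernel (Hom A X (cob S n)) (Hom A X (cob S (n + 1))) (Comp A X (cob S n) (cob S (n + 1)) (cdiff S n))
     = Comp A X (cob S (n - 1)) (cob S n) (cdiff S (n - 1)) ` Mor A X (cob S (n - 1)))
    \<longleftrightarrow> (\<forall>x \<in> Mor A X (cob S n).
      Comp A X (cob S n) (cob S (n + 1)) (cdiff S n) x = Zero A X (cob S (n + 1)) \<longrightarrow>
      (\<exists>y \<in> Mor A X (cob S (n - 1)). Comp A X (cob S (n - 1)) (cob S n) (cdiff S (n - 1)) y = x))"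
    if "X \<in> \<X>" for X n
  proof -
    have [simp]: "X \<in> Ob A" using X that by auto
    note [simp] = S
    show ?thesis
      unfolding kernel_def by (auto simp: set_eq_iff image_iff) metis
  qed
  then show ?thesis
    unfolding is_X_acyclic_def acyclic_groups_def by simp
qed

text \<open>
  For a target with zero differential this says that \<open>Hom(X, s)\<close> induces a bijection in cohomology
  for all \<open>X \<in> \<X>\<close>: the first half is injectivity, the second surjectivity.
\<close>

definition resolves where
  "resolves \<X> C D s \<longleftrightarrow> (\<forall>X \<in> \<X>. \<forall>i.
    (\<forall>x \<in> Mor A X (cob C i).
      Comp A X (cob C i) (cob C (i + 1)) (cdiff C i) x = Zero A X (cob C (i + 1)) \<longrightarrow>
      Comp A X (cob C i) (cob D i) (s i) x = Zero A X (cob D i) \<longrightarrow>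
      (\<exists>y \<in> Mor A X (cob C (i - 1)). Comp A X (cob C (i - 1)) (cob C i) (cdiff C (i - 1)) y = x)) \<and>
    (\<forall>y \<in> Mor A X (cob D i). \<exists>x \<in> Mor A X (cob C i).
      Comp A X (cob C i) (cob C (i + 1)) (cdiff C i) x = Zero A X (cob C (i + 1)) \<and>
      Comp A X (cob C i) (cob D i) (s i) x = y))"

lemma resolves_lift_cycle:
  assumes "resolves \<X> C D s" "X \<in> \<X>" "j = i + 1" "h = i - 1" "x \<in> Mor A X (cob C i)"
    "Comp A X (cob C i) (cob C j) (cdiff C i) x = Zero A X (cob C j)"
    "Comp A X (cob C i) (cob D i) (s i) x = Zero A X (cob D i)"
  shows "\<exists>y \<in> Mor A X (cob C h). Comp A X (cob C h) (cob C i) (cdiff C h) y = x"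
  using assms unfolding resolves_def by blast

lemma resolves_lift:
  assumes "resolves \<X> C D s" "X \<in> \<X>" "j = i + 1" "y \<in> Mor A X (cob D i)"
  shows "\<exists>x \<in> Mor A X (cob C i).
      Comp A X (cob C i) (cob C j) (cdiff C i) x = Zero A X (cob C j) \<and>
      Comp A X (cob C i) (cob D i) (s i) x = y"
  using assms unfolding resolves_def by blast

end

locale mapping_cone = preadditive_category A for A :: "('o, 'm) preadd" +
  fixes C D E :: "('o, 'm) cpx" and f i1 i2 p1 p2 :: "int \<Rightarrow> 'm"
  assumes C [simp]: "is_complex A C" and D [simp]: "is_complex A D" and f [simp]: "chain_map C D f"
    and bp: "is_biproduct A (cob C (i + 1)) (cob D i) (cob E i) (i1 i) (i2 i) (p1 i) (p2 i)"
    and diff: "cdiff E i =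
        Add A (cob E i) (cob E (i + 1))
          (Comp A (cob E i) (cob C (i + 1)) (cob E (i + 1))
            (Add A (cob C (i + 1)) (cob E (i + 1))
              (Comp A (cob C (i + 1)) (cob C (i + 2)) (cob E (i + 1)) (i1 (i + 1))
                (Neg A (cob C (i + 1)) (cob C (i + 2)) (cdiff C (i + 1))))
              (Comp A (cob C (i + 1)) (cob D (i + 1)) (cob E (i + 1)) (i2 (i + 1)) (f (i + 1))))
            (p1 i))
          (Comp A (cob E i) (cob D i) (cob E (i + 1))
            (Comp A (cob D i) (cob D (i + 1)) (cob E (i + 1)) (i2 (i + 1)) (cdiff D i))
            (p2 i))"
begin

lemma cone_mem [simp]:
  "cob E i \<in> Ob A" "j = i + 1 \<Longrightarrow> i1 i \<in> Mor A (cob C j) (cob E i)" "i2 i \<in> Mor A (cob D i) (cob E i)"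
  "j = i + 1 \<Longrightarrow> p1 i \<in> Mor A (cob E i) (cob C j)" "p2 i \<in> Mor A (cob E i) (cob D i)"
  using biproduct_mem[OF bp] by simp_all

definition pair where
  "pair W i a b = Add A W (cob E i) (Comp A W (cob C (i + 1)) (cob E i) (i1 i) a)
    (Comp A W (cob D i) (cob E i) (i2 i) b)"

lemma pair_mem [simp]:
  "\<lbrakk>W \<in> Ob A; a \<in> Mor A W (cob C (i + 1)); b \<in> Mor A W (cob D i)\<rbrakk> \<Longrightarrow> pair W i a b \<in> Mor A W (cob E i)"
  by (simp add: pair_def)

lemma pair_proj:
  assumes "W \<in> Ob A" "a \<in> Mor A W (cob C (i + 1))" "b \<in> Mor A W (cob D i)"
  shows "Comp A W (cob E i) (cob C (i + 1)) (p1 i) (pair W i a b) = a"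
    and "Comp A W (cob E i) (cob D i) (p2 i) (pair W i a b) = b"
  unfolding pair_def using assms by (auto intro!: biproduct_proj[OF bp])

lemma pair_inject:
  assumes "W \<in> Ob A" "a \<in> Mor A W (cob C (i + 1))" "b \<in> Mor A W (cob D i)"
    "a' \<in> Mor A W (cob C (i + 1))" "b' \<in> Mor A W (cob D i)"
  shows "pair W i a b = pair W i a' b' \<longleftrightarrow> a = a' \<and> b = b'"
  using pair_proj[of W a i b] pair_proj[of W a' i b'] assms by auto

lemma pair_cases:
  assumes "W \<in> Ob A" "x \<in> Mor A W (cob E i)"
  obtains a b where "a \<in> Mor A W (cob C (i + 1))" "b \<in> Mor A W (cob D i)" "x = pair W i a b"
proof (rule that)
  show "x = pair W i (Comp A W (cob E i) (cob C (i + 1)) (p1 i) x) (Comp A W (cob E i) (cob D i) (p2 i) x)"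
    unfolding pair_def by (rule biproduct_decompose[OF bp]) (simp_all add: assms)
qed (simp_all add: assms)

lemma pair_Zero:
  "W \<in> Ob A \<Longrightarrow> pair W i (Zero A W (cob C (i + 1))) (Zero A W (cob D i)) = Zero A W (cob E i)"
  by (simp add: pair_def)

lemma cdiff_cone_mem [simp]: "j = i + 1 \<Longrightarrow> cdiff E i \<in> Mor A (cob E i) (cob E j)"
  unfolding diff by simp

text \<open>
  The formula \<open>(a, b) \<mapsto> (- d a, f a + d b)\<close> of the cone, on generalized elements.
\<close>

lemma cdiff_pair:
  assumes [simp]: "W \<in> Ob A" "a \<in> Mor A W (cob C (i + 1))" "b \<in> Mor A W (cob D i)"
  shows "Comp A W (cob E i) (cob E (i + 1)) (cdiff E i) (pair W i a b)
    = pair W (i + 1)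
        (Neg A W (cob C (i + 2)) (Comp A W (cob C (i + 1)) (cob C (i + 2)) (cdiff C (i + 1)) a))
        (Add A W (cob D (i + 1)) (Comp A W (cob C (i + 1)) (cob D (i + 1)) (f (i + 1)) a)
          (Comp A W (cob D i) (cob D (i + 1)) (cdiff D i) b))"
  unfolding diff
  by (simp add: Comp_Add_left Comp_assoc pair_proj)
    (simp add: pair_def Comp_Add_right Add_assoc Comp_Neg_left)

lemma cone_complex: "is_complex A E"
proof -
  have "Comp A (cob E i) (cob E (i + 1)) (cob E (i + 2)) (cdiff E (i + 1)) (cdiff E i)
      = Zero A (cob E i) (cob E (i + 2))" for i
  proof -
    define W where "W = cob E i"
    have [simp]: "W \<in> Ob A" by (simp add: W_def)
    obtain a b where [simp]: "a \<in> Mor A W (cob C (i + 1))" "b \<in> Mor A W (cob D i)"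
      and id: "Ident A W = pair W i a b"
      using pair_cases[of W "Ident A W" i] by (auto simp: W_def)
    have "cdiff E i = Comp A W W (cob E (i + 1)) (cdiff E i) (Ident A W)"
      by (simp add: W_def)
    also have "\<dots> = pair W (i + 1)
        (Neg A W (cob C (i + 2)) (Comp A W (cob C (i + 1)) (cob C (i + 2)) (cdiff C (i + 1)) a))
        (Add A W (cob D (i + 1)) (Comp A W (cob C (i + 1)) (cob D (i + 1)) (f (i + 1)) a)
          (Comp A W (cob D i) (cob D (i + 1)) (cdiff D i) b))"
      unfolding id using cdiff_pair[of W a i b, folded W_def] by simp
    also have "Comp A W (cob E (i + 1)) (cob E (i + 2)) (cdiff E (i + 1)) \<dots> = Zero A W (cob E (i + 2))"
      (is "Comp A W _ _ _ (pair W _ ?a ?b) = _")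
    proof -
      have fd: "Comp A W (cob C (i + 1)) (cob D (i + 2)) (Comp A (cob C (i + 1)) (cob C (i + 2)) (cob D (i + 2)) (f (i + 2)) (cdiff C (i + 1))) a
        = Comp A W (cob C (i + 1)) (cob D (i + 2)) (Comp A (cob C (i + 1)) (cob D (i + 1)) (cob D (i + 2)) (cdiff D (i + 1)) (f (i + 1))) a"
        using chain_map_commute[OF f, of "i + 2" "i + 1"] by simp
      have "Comp A W (cob E (i + 1)) (cob E (i + 1 + 1)) (cdiff E (i + 1)) (pair W (i + 1) ?a ?b)
        = pair W (i + 1 + 1) (Zero A W (cob C (i + 1 + 1 + 1))) (Zero A W (cob D (i + 1 + 1)))"
        by (subst cdiff_pair)
          (simp_all add: Comp_Neg_right Comp_Add_right fd[simplified Comp_assoc] flip: Comp_assoc)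
      then show ?thesis by (simp only: pair_Zero \<open>W \<in> Ob A\<close>) simp
    qed
    finally show ?thesis by (simp add: W_def)
  qed
  then show ?thesis by (simp add: is_complex_def del: complex_mem cdiff_mem cdiff_cdiff)
qed

text \<open>
  The long exact sequence of the cone, by elements. As \<open>D\<close> has zero differential, \<open>(a, b)\<close> is a cycle
  iff \<open>d a = 0\<close> and \<open>f a = 0\<close>, and it is the boundary of \<open>(a', b')\<close> iff \<open>a = - d a'\<close> and \<open>b = f a'\<close>.
  The cycles \<open>(a, 0)\<close> give injectivity in cohomology and the cycles \<open>(0, b)\<close> give surjectivity.
\<close>

lemma cone_acyclic_iff:
  assumes X: "\<X> \<subseteq> Ob A" and zd: "\<And>i. cdiff D i = Zero A (cob D i) (cob D (i + 1))"
  shows "is_X_acyclic A \<X> E \<longleftrightarrow> resolves \<X> C D f"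
proof
  assume ac: "is_X_acyclic A \<X> E"
  have bdry: "\<exists>a' \<in> Mor A X (cob C i).
      Neg A X (cob C (i + 1)) (Comp A X (cob C i) (cob C (i + 1)) (cdiff C i) a') = a \<and>
      Comp A X (cob C i) (cob D i) (f i) a' = b"
    if "X \<in> \<X>" and a [simp]: "a \<in> Mor A X (cob C (i + 1))" and b [simp]: "b \<in> Mor A X (cob D i)"
      and da: "Comp A X (cob C (i + 1)) (cob C (i + 2)) (cdiff C (i + 1)) a = Zero A X (cob C (i + 2))"
      and fa: "Comp A X (cob C (i + 1)) (cob D (i + 1)) (f (i + 1)) a = Zero A X (cob D (i + 1))"
    for X a b i
  proof -
    have X' [simp]: "X \<in> Ob A" using X that by auto
    have "Comp A X (cob E i) (cob E (i + 1)) (cdiff E i) (pair X i a b) = Zero A X (cob E (i + 1))"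
      using pair_Zero[of X "i + 1"] by (simp add: cdiff_pair da fa zd)
    then obtain y where y: "y \<in> Mor A X (cob E (i - 1))"
      "Comp A X (cob E (i - 1)) (cob E i) (cdiff E (i - 1)) y = pair X i a b"
      using ac \<open>X \<in> \<X>\<close> unfolding X_acyclic_iff[OF cone_complex X] by (meson a b X' pair_mem)
    obtain a' b' where [simp]: "a' \<in> Mor A X (cob C i)" "b' \<in> Mor A X (cob D (i - 1))"
      and y_eq: "y = pair X (i - 1) a' b'"
      using pair_cases[OF X' y(1)] by (metis diff_add_cancel)
    have "pair X i (Neg A X (cob C (i + 1)) (Comp A X (cob C i) (cob C (i + 1)) (cdiff C i) a'))
        (Comp A X (cob C i) (cob D i) (f i) a') = pair X i a b"
      using y(2) cdiff_pair[of X a' "i - 1" b'] unfolding y_eq by (simp add: zd)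
    then show ?thesis
      by (subst (asm) pair_inject) auto
  qed
  show "resolves \<X> C D f"
    unfolding resolves_def
  proof (intro ballI allI conjI impI)
    fix X i x assume "X \<in> \<X>" "x \<in> Mor A X (cob C i)"
      and z: "Comp A X (cob C i) (cob C (i + 1)) (cdiff C i) x = Zero A X (cob C (i + 1))"
        "Comp A X (cob C i) (cob D i) (f i) x = Zero A X (cob D i)"
    then have [simp]: "X \<in> Ob A" "x \<in> Mor A X (cob C i)" using X by auto
    obtain a' where [simp]: "a' \<in> Mor A X (cob C (i - 1))"
      and eq: "Neg A X (cob C i) (Comp A X (cob C (i - 1)) (cob C i) (cdiff C (i - 1)) a') = x"
      using bdry[of X x "i - 1" "Zero A X (cob D (i - 1))"] z \<open>X \<in> \<X>\<close> by auto
    show "\<exists>y \<in> Mor A X (cob C (i - 1)). Comp A X (cob C (i - 1)) (cob C i) (cdiff C (i - 1)) y = x"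
      by (rule bexI[of _ "Neg A X (cob C (i - 1)) a'"]) (simp_all add: Comp_Neg_right eq)
  next
    fix X i y assume y: "X \<in> \<X>" "y \<in> Mor A X (cob D i)"
    then have [simp]: "X \<in> Ob A" using X by auto
    obtain a' where [simp]: "a' \<in> Mor A X (cob C i)"
      and eq: "Neg A X (cob C (i + 1)) (Comp A X (cob C i) (cob C (i + 1)) (cdiff C i) a') = Zero A X (cob C (i + 1))"
       "Comp A X (cob C i) (cob D i) (f i) a' = y"
      using bdry[of X "Zero A X (cob C (i + 1))" i y] y by auto
    have "Comp A X (cob C i) (cob C (i + 1)) (cdiff C i) a' = Zero A X (cob C (i + 1))"
      using arg_cong[OF eq(1), of "Neg A X (cob C (i + 1))"] by simp
    with eq(2) show "\<exists>x \<in> Mor A X (cob C i).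
        Comp A X (cob C i) (cob C (i + 1)) (cdiff C i) x = Zero A X (cob C (i + 1)) \<and>
        Comp A X (cob C i) (cob D i) (f i) x = y"
      by auto
  qed
next
  assume res: "resolves \<X> C D f"
  show "is_X_acyclic A \<X> E"
    unfolding X_acyclic_iff[OF cone_complex X]
  proof (intro ballI allI impI)
    fix X i x assume X1: "X \<in> \<X>" and x: "x \<in> Mor A X (cob E i)"
      and dx: "Comp A X (cob E i) (cob E (i + 1)) (cdiff E i) x = Zero A X (cob E (i + 1))"
    then have [simp]: "X \<in> Ob A" using X by auto
    obtain a b where [simp]: "a \<in> Mor A X (cob C (i + 1))" "b \<in> Mor A X (cob D i)"
      and x_eq: "x = pair X i a b"
      using pair_cases[OF _ x] by auto
    have "pair X (i + 1)
        (Neg A X (cob C (i + 2)) (Comp A X (cob C (i + 1)) (cob C (i + 2)) (cdiff C (i + 1)) a))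
        (Comp A X (cob C (i + 1)) (cob D (i + 1)) (f (i + 1)) a)
      = pair X (i + 1) (Zero A X (cob C (i + 1 + 1))) (Zero A X (cob D (i + 1)))"
      using dx unfolding x_eq using pair_Zero[of X "i + 1"] by (simp add: cdiff_pair zd)
    then have nda: "Neg A X (cob C (i + 2)) (Comp A X (cob C (i + 1)) (cob C (i + 2)) (cdiff C (i + 1)) a) = Zero A X (cob C (i + 2))"
      and fa: "Comp A X (cob C (i + 1)) (cob D (i + 1)) (f (i + 1)) a = Zero A X (cob D (i + 1))"
      by (subst (asm) pair_inject; simp)+
    have da: "Comp A X (cob C (i + 1)) (cob C (i + 2)) (cdiff C (i + 1)) a = Zero A X (cob C (i + 2))"
      using arg_cong[OF nda, of "Neg A X (cob C (i + 2))"] by simp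
    \<comment> \<open>A primitive \<open>a1\<close> of \<open>a\<close> may have the wrong value under \<open>f\<close>; the cycle \<open>z\<close> corrects it.\<close>
    obtain a1 where [simp]: "a1 \<in> Mor A X (cob C i)"
      and a1: "Comp A X (cob C i) (cob C (i + 1)) (cdiff C i) a1 = a"
      using resolves_lift_cycle[OF res X1 _ _ _ da fa, of i] by auto
    define b1 where "b1 = Add A X (cob D i) b (Comp A X (cob C i) (cob D i) (f i) a1)"
    obtain z where [simp]: "z \<in> Mor A X (cob C i)"
      and z: "Comp A X (cob C i) (cob C (i + 1)) (cdiff C i) z = Zero A X (cob C (i + 1))"
        "Comp A X (cob C i) (cob D i) (f i) z = b1"
      using resolves_lift[OF res X1, of "i + 1" i b1] by (auto simp: b1_def)
    define y where "y = pair X (i - 1) (Add A X (cob C i) z (Neg A X (cob C i) a1)) (Zero A X (cob D (i - 1)))"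
    have "y \<in> Mor A X (cob E (i - 1))" by (simp add: y_def)
    moreover have "Comp A X (cob E (i - 1)) (cob E i) (cdiff E (i - 1)) y = x"
      using cdiff_pair[of X "Add A X (cob C i) z (Neg A X (cob C i) a1)" "i - 1" "Zero A X (cob D (i - 1))"]
      by (simp add: y_def x_eq zd Comp_Add_right Comp_Neg_right z a1 b1_def Add_assoc)
    ultimately show "\<exists>y \<in> Mor A X (cob E (i - 1)). Comp A X (cob E (i - 1)) (cob E i) (cdiff E (i - 1)) y = x"
      by auto
  qed
qed

end

context preadditive_category
begin

lemma is_cone_mapping_cone:
  assumes "is_complex A C" "is_complex A D" "chain_map C D f" "is_cone A C D f E"
  obtains i1 i2 p1 p2 where "mapping_cone A C D E f i1 i2 p1 p2"
  using assms preadditive_category_axioms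
  unfolding is_cone_def mapping_cone_def mapping_cone_axioms_def by blast

end

context abelian_category
begin

lemma bounded_cone_exists:
  assumes C: "bounded_complex A C" and D: "bounded_complex A D" and f: "chain_map C D f"
  shows "\<exists>E. bounded_complex A E \<and> is_cone A C D f E"
proof -
  have [simp]: "is_complex A C" "is_complex A D" using C D by simp_all
  obtain a b a' b' where
    z: "\<And>i. i < a \<or> b < i \<Longrightarrow> is_zero_ob A (cob C i)" "\<And>i. i < a' \<or> b' < i \<Longrightarrow> is_zero_ob A (cob D i)"
    using C D unfolding bounded_complex_def by blast
  have "\<forall>i. \<exists>B i1 i2 p1 p2. is_biproduct A (cob C (i + 1)) (cob D i) B i1 i2 p1 p2"
    using ex_biproduct by simp
  then obtain B i1 i2 p1 p2 where
    bp: "\<And>i. is_biproduct A (cob C (i + 1)) (cob D i) (B i) (i1 i) (i2 i) (p1 i) (p2 i)"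
    by metis
  define E where "E = \<lparr>cob = B, cdiff = (\<lambda>i. Add A (B i) (B (i + 1))
          (Comp A (B i) (cob C (i + 1)) (B (i + 1))
            (Add A (cob C (i + 1)) (B (i + 1))
              (Comp A (cob C (i + 1)) (cob C (i + 2)) (B (i + 1)) (i1 (i + 1))
                (Neg A (cob C (i + 1)) (cob C (i + 2)) (cdiff C (i + 1))))
              (Comp A (cob C (i + 1)) (cob D (i + 1)) (B (i + 1)) (i2 (i + 1)) (f (i + 1))))
            (p1 i))
          (Comp A (B i) (cob D i) (B (i + 1))
            (Comp A (cob D i) (cob D (i + 1)) (B (i + 1)) (i2 (i + 1)) (cdiff D i))
            (p2 i)))\<rparr>"
  interpret mapping_cone A C D E f i1 i2 p1 p2
    by unfold_locales (simp_all add: E_def bp f)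
  have "is_zero_ob A (cob E i)" if "i < min (a - 1) a' \<or> max b b' < i" for i
    by (rule biproduct_zero_ob[OF mapping_cone.bp[OF mapping_cone_axioms]]) (use z that in auto)
  then have "bounded_complex A E"
    using cone_complex unfolding bounded_complex_def by blast
  moreover have "is_cone A C D f E"
    unfolding is_cone_def using diff mapping_cone.bp[OF mapping_cone_axioms] by blast
  ultimately show ?thesis by blast
qed

text \<open>
  A description of denominators without cones: in one direction it provides lifts along denominators,
  in the other it recognizes the truncations of a resolution as denominators.
\<close>

lemma Kb_denominators_iff:
  assumes X: "\<X> \<subseteq> Ob A" and C: "bounded_complex A C" and D: "bounded_complex A D"
    and zd: "\<And>i. cdiff D i = Zero A (cob D i) (cob D (i + 1))"
  shows "F \<in> Kb_denominators A \<X> C D \<longleftrightarrow>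
    (\<exists>f. chain_map C D f \<and> resolves \<X> C D f \<and> F = homotopy_class A C D f)"
proof -
  have [simp]: "is_complex A C" "is_complex A D" using C D by simp_all
  have iff: "(\<exists>E \<in> Kb_acyclic A \<X>. is_cone A C D f E) \<longleftrightarrow> resolves \<X> C D f" if f: "chain_map C D f" for f
  proof -
    have *: "is_X_acyclic A \<X> E \<longleftrightarrow> resolves \<X> C D f" if E: "is_cone A C D f E" for E
    proof -
      obtain i1 i2 p1 p2 where "mapping_cone A C D E f i1 i2 p1 p2"
        using is_cone_mapping_cone[OF \<open>is_complex A C\<close> \<open>is_complex A D\<close> f E] by blast
      then show ?thesis using mapping_cone.cone_acyclic_iff[OF _ X zd] by blast
    qed
    with bounded_cone_exists[OF C D f] show ?thesis
      unfolding Kb_acyclic_def Kb_Ob by blast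
  qed
  show ?thesis
  proof
    assume "F \<in> Kb_denominators A \<X> C D"
    then obtain f where f: "F \<in> Mor (Kb A) C D" "f \<in> F" "\<exists>E \<in> Kb_acyclic A \<X>. is_cone A C D f E"
      by (auto simp: Kb_denominators_def)
    then show "\<exists>f. chain_map C D f \<and> resolves \<X> C D f \<and> F = homotopy_class A C D f"
      using Kb_Mor_obtain[OF _ _ f(1,2)] iff by auto
  next
    assume "\<exists>f. chain_map C D f \<and> resolves \<X> C D f \<and> F = homotopy_class A C D f"
    then obtain f where f: "chain_map C D f" "resolves \<X> C D f" "F = homotopy_class A C D f" by blast
    then show "F \<in> Kb_denominators A \<X> C D"
      using iff[OF f(1)] homotopy_class_self[of C D f] by (auto simp: Kb_denominators_def Kb_Mor)
  qed
qed

end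

section \<open>Morphisms of a localization that are computed by a resolution\<close>

text \<open>
  In a calculus of fractions, the morphisms from \<open>T\<close> to \<open>Y\<close> form the colimit of \<open>Hom(Z, Y)\<close> over all
  denominators \<open>Z \<rightarrow> T\<close>. The object \<open>P\<close>, which need not lie in the category \<open>B\<close> that is localized,
  behaves like the limit of these denominators: it maps to each of them in a unique way over \<open>T\<close>, and
  any finite set of objects is unable to distinguish \<open>P\<close> from some denominator \<open>W \<rightarrow> T\<close>. This turns
  fractions into morphisms out of \<open>P\<close>.
\<close>

locale localizing_resolution = preadditive_category K for K :: "('o, 'm) preadd" +
  fixes B :: "'o set" and S :: "'o \<Rightarrow> 'o \<Rightarrow> 'm set" and P T :: 'o and p :: 'm
  assumes B_Ob: "B \<subseteq> Ob K" and P_Ob: "P \<in> Ob K" and T_B: "T \<in> B" and p: "p \<in> Mor K P T"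
    and S_Mor: "\<And>Z. Z \<in> B \<Longrightarrow> S Z T \<subseteq> Mor K Z T"
    and lift: "\<And>Z s. \<lbrakk>Z \<in> B; s \<in> S Z T\<rbrakk> \<Longrightarrow> \<exists>!l. l \<in> Mor K P Z \<and> Comp K P Z T s l = p"
    and approx: "\<And>\<Y>. \<lbrakk>finite \<Y>; \<Y> \<subseteq> B\<rbrakk> \<Longrightarrow> \<exists>W \<in> B. \<exists>w \<in> S W T. \<exists>q \<in> Mor K P W.
      Comp K P W T w q = p \<and> (\<forall>Y \<in> \<Y>. bij_betw (\<lambda>g. Comp K P W Y g q) (Mor K W Y) (Mor K P Y))"
begin

definition lift_along :: "'o \<Rightarrow> 'm \<Rightarrow> 'm" where
  "lift_along Z s = (THE l. l \<in> Mor K P Z \<and> Comp K P Z T s l = p)"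

lemma lift_along:
  assumes "Z \<in> B" "s \<in> S Z T"
  shows "lift_along Z s \<in> Mor K P Z" "Comp K P Z T s (lift_along Z s) = p"
  using theI'[OF lift[OF assms]] by (simp_all add: lift_along_def)

lemma lift_along_unique:
  "\<lbrakk>Z \<in> B; s \<in> S Z T; l \<in> Mor K P Z; Comp K P Z T s l = p\<rbrakk> \<Longrightarrow> lift_along Z s = l"
  using lift[of Z s] lift_along[of Z s] by blast

text \<open>
  The fraction \<open>f s\<^sup>-\<^sup>1\<close>, precomposed with \<open>p : P \<rightarrow> T\<close>.
\<close>

definition roof_value :: "'o \<Rightarrow> 'o \<times> 'm \<times> 'm \<Rightarrow> 'm" where
  "roof_value Y = (\<lambda>(Z, s, f). Comp K P Z Y f (lift_along Z s))"

abbreviation "L \<equiv> K\<lparr>Ob := B\<rparr>"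

lemma roofs_iff: "(Z, s, f) \<in> roofs L S T Y \<longleftrightarrow> Z \<in> B \<and> s \<in> S Z T \<and> f \<in> Mor K Z Y"
  by (simp add: roofs_def)

lemma B_Ob' [simp]: "Z \<in> B \<Longrightarrow> Z \<in> Ob K"
  using B_Ob by auto

text \<open>
  A roof dominating two roofs has a lift, which induces the lifts of both, so related roofs have the
  same value. Conversely, a denominator \<open>W\<close> that the objects \<open>Z\<close>, \<open>Z'\<close>, \<open>T\<close>, \<open>Y\<close> cannot distinguish
  from \<open>P\<close> dominates both roofs: the two lifts, and all equations between morphisms out of \<open>P\<close>, descend
  to \<open>W\<close>. Thus \<open>roof_rel\<close> is the equivalence relation of having the same value.
\<close>

lemma roof_rel_iff:
  assumes Y: "Y \<in> B" and r: "(Z, s, f) \<in> roofs L S T Y" "(Z', s', f') \<in> roofs L S T Y"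
  shows "((Z, s, f), (Z', s', f')) \<in> roof_rel L S T Y \<longleftrightarrow>
    roof_value Y (Z, s, f) = roof_value Y (Z', s', f')"
proof -
  note [simp] = P_Ob T_B Y
  have Z [simp]: "Z \<in> B" "Z' \<in> B" and s: "s \<in> S Z T" "s' \<in> S Z' T"
    and f [simp]: "f \<in> Mor K Z Y" "f' \<in> Mor K Z' Y"
    using r by (simp_all add: roofs_iff)
  have s' [simp]: "s \<in> Mor K Z T" "s' \<in> Mor K Z' T" using s S_Mor Z by blast+
  note [simp] = lift_along[OF Z(1) s(1)] lift_along[OF Z(2) s(2)]
  show ?thesis
  proof
    assume "((Z, s, f), (Z', s', f')) \<in> roof_rel L S T Y"
    then obtain W u u' where W [simp]: "W \<in> B" and u [simp]: "u \<in> Mor K W Z" "u' \<in> Mor K W Z'"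
      and eq: "Comp K W Z T s u = Comp K W Z' T s' u'" and su: "Comp K W Z T s u \<in> S W T"
      and f_eq: "Comp K W Z Y f u = Comp K W Z' Y f' u'"
      by (auto simp: roof_rel_def)
    define l where "l = lift_along W (Comp K W Z T s u)"
    have l [simp]: "l \<in> Mor K P W" and lp: "Comp K P W T (Comp K W Z T s u) l = p"
      using lift_along[OF W su] by (simp_all add: l_def)
    have "lift_along Z s = Comp K P W Z u l"
      by (rule lift_along_unique) (use lp s in \<open>simp_all flip: Comp_assoc\<close>)
    moreover have "lift_along Z' s' = Comp K P W Z' u' l"
      by (rule lift_along_unique) (use lp s in \<open>simp_all add: eq flip: Comp_assoc\<close>)
    ultimately show "roof_value Y (Z, s, f) = roof_value Y (Z', s', f')"
      by (simp add: roof_value_def f_eq flip: Comp_assoc)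
  next
    assume eq: "roof_value Y (Z, s, f) = roof_value Y (Z', s', f')"
    obtain W w q where W [simp]: "W \<in> B" and w: "w \<in> S W T" and q [simp]: "q \<in> Mor K P W"
      and wq: "Comp K P W T w q = p"
      and bij: "\<And>V. V \<in> {Z, Z', T, Y} \<Longrightarrow> bij_betw (\<lambda>g. Comp K P W V g q) (Mor K W V) (Mor K P V)"
      using approx[of "{Z, Z', T, Y}"] by auto
    have inj: "g = g'" if "V \<in> {Z, Z', T, Y}" "g \<in> Mor K W V" "g' \<in> Mor K W V"
      "Comp K P W V g q = Comp K P W V g' q" for V g g'
      using bij[OF that(1)] that(2-) unfolding bij_betw_def inj_on_def by blast
    have surj: "\<exists>u \<in> Mor K W V. Comp K P W V u q = l" if "V \<in> {Z, Z', T, Y}" "l \<in> Mor K P V" for V l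
      using that(2) unfolding bij_betw_imp_surj_on[OF bij[OF that(1)], symmetric] by auto
    have w' [simp]: "w \<in> Mor K W T" using w S_Mor W by blast
    obtain u where u [simp]: "u \<in> Mor K W Z" and uq: "Comp K P W Z u q = lift_along Z s"
      using surj[of Z "lift_along Z s"] by auto
    obtain u' where u' [simp]: "u' \<in> Mor K W Z'" and uq': "Comp K P W Z' u' q = lift_along Z' s'"
      using surj[of Z' "lift_along Z' s'"] by auto
    have "Comp K W Z T s u = w"
      by (rule inj[of T]) (simp_all add: wq Comp_assoc uq)
    moreover have "Comp K W Z' T s' u' = w"
      by (rule inj[of T]) (simp_all add: wq Comp_assoc uq')
    moreover have "Comp K W Z Y f u = Comp K W Z' Y f' u'"
      by (rule inj[of Y]) (use eq in \<open>simp_all add: Comp_assoc uq uq' roof_value_def\<close>)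
    ultimately have "\<exists>W \<in> B. \<exists>u \<in> Mor K W Z. \<exists>u' \<in> Mor K W Z'.
        Comp K W Z T s u = Comp K W Z' T s' u' \<and> Comp K W Z T s u \<in> S W T \<and>
        Comp K W Z Y f u = Comp K W Z' Y f' u'"
      using w by (intro bexI[OF _ W] bexI[OF _ u] bexI[OF _ u']) simp
    then show "((Z, s, f), (Z', s', f')) \<in> roof_rel L S T Y"
      using r by (simp add: roof_rel_def)
  qed
qed

lemma roof_value_mem: "\<lbrakk>Y \<in> B; r \<in> roofs L S T Y\<rbrakk> \<Longrightarrow> roof_value Y r \<in> Mor K P Y"
  using lift_along P_Ob by (auto simp: roofs_def roof_value_def)

definition roof_class :: "'o \<Rightarrow> 'm \<Rightarrow> ('o \<times> 'm \<times> 'm) set" where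
  "roof_class Y g = {r \<in> roofs L S T Y. roof_value Y r = g}"

lemma fraction_eq:
  assumes "Y \<in> B" "r \<in> roofs L S T Y"
  shows "fraction L S T Y r = roof_class Y (roof_value Y r)"
proof -
  have "roof_rel L S T Y \<subseteq> roofs L S T Y \<times> roofs L S T Y"
    by (auto simp: roof_rel_def)
  with assms show ?thesis
    using roof_rel_iff[OF assms(1)]
    by (cases r) (auto simp: fraction_def roof_class_def split_paired_all)
qed

text \<open>
  The denominator depends on \<open>Y\<close> alone, so any two fractions with target \<open>Y\<close> can be written with it;
  this makes the union that defines their sum nonempty.
\<close>

lemma roof_value_surj:
  assumes Y: "Y \<in> B"
  obtains Z s where "Z \<in> B" "s \<in> S Z T"
    "\<And>g. g \<in> Mor K P Y \<Longrightarrow> \<exists>f \<in> Mor K Z Y. roof_value Y (Z, s, f) = g"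
proof -
  obtain W w q where W: "W \<in> B" "w \<in> S W T" and q: "q \<in> Mor K P W" "Comp K P W T w q = p"
    and bij: "bij_betw (\<lambda>g. Comp K P W Y g q) (Mor K W Y) (Mor K P Y)"
    using approx[of "{Y}"] Y by auto
  have "\<exists>f \<in> Mor K W Y. roof_value Y (W, w, f) = g" if "g \<in> Mor K P Y" for g
    using that lift_along_unique[OF W q] unfolding bij_betw_imp_surj_on[OF bij, symmetric]
    by (auto simp: roof_value_def)
  with W that show ?thesis by blast
qed

theorem Hom_localization_iso:
  assumes Y: "Y \<in> B"
  shows "Hom K P Y \<cong> Hom (localization L S) T Y"
proof -
  let ?H = "Hom (localization L S) T Y"
  obtain Z s where Z: "Z \<in> B" and s: "s \<in> S Z T"
    and surj: "\<And>g. g \<in> Mor K P Y \<Longrightarrow> \<exists>f \<in> Mor K Z Y. roof_value Y (Z, s, f) = g"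
    using roof_value_surj[OF Y] by blast
  have nonempty: "\<exists>f. (Z, s, f) \<in> roof_class Y g" if "g \<in> Mor K P Y" for g
    using surj[OF that] Z s by (auto simp: roof_class_def roofs_iff)
  have carrier: "carrier ?H = roof_class Y ` Mor K P Y"
  proof -
    have "carrier ?H = fraction L S T Y ` roofs L S T Y"
      by (auto simp: localization_def quotient_def fraction_def)
    also have "\<dots> = roof_class Y ` roof_value Y ` roofs L S T Y"
      using fraction_eq[OF Y] by (auto simp: image_iff)
    also have "roof_value Y ` roofs L S T Y = Mor K P Y"
      using roof_value_mem[OF Y] nonempty by (fastforce simp: roof_class_def)
    finally show ?thesis .
  qed
  have inj: "inj_on (roof_class Y) (Mor K P Y)"
  proof (rule inj_onI)
    fix g h assume "g \<in> Mor K P Y" "roof_class Y g = roof_class Y h"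
    with nonempty[of g] show "g = h" by (auto simp: roof_class_def)
  qed
  have add: "roof_class Y (Add K P Y g h) = roof_class Y g \<otimes>\<^bsub>?H\<^esub> roof_class Y h"
    if gh: "g \<in> Mor K P Y" "h \<in> Mor K P Y" for g h
  proof -
    have sum: "fraction L S T Y (U, t, Add K U Y f f') = roof_class Y (Add K P Y g h)"
      if "(U, t, f) \<in> roof_class Y g" "(U, t, f') \<in> roof_class Y h" for U t f f'
    proof -
      have r: "U \<in> B" "t \<in> S U T" "f \<in> Mor K U Y" "f' \<in> Mor K U Y"
        and v: "roof_value Y (U, t, f) = g" "roof_value Y (U, t, f') = h"
        using that by (auto simp: roof_class_def roofs_iff)
      have "(U, t, Add K U Y f f') \<in> roofs L S T Y"
        using r Y by (simp add: roofs_iff)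
      moreover have "roof_value Y (U, t, Add K U Y f f') = Add K P Y g h"
        using r v Y P_Ob lift_along[OF r(1,2)] by (auto simp: roof_value_def Comp_Add_left)
      ultimately show ?thesis using fraction_eq[OF Y] by metis
    qed
    have "roof_class Y g \<otimes>\<^bsub>?H\<^esub> roof_class Y h
      = \<Union>{fraction L S T Y (U, t, Add K U Y f f') | U t f f'.
          (U, t, f) \<in> roof_class Y g \<and> (U, t, f') \<in> roof_class Y h}"
      by (simp add: localization_def)
    also have "{fraction L S T Y (U, t, Add K U Y f f') | U t f f'.
          (U, t, f) \<in> roof_class Y g \<and> (U, t, f') \<in> roof_class Y h} = {roof_class Y (Add K P Y g h)}"
      using nonempty[OF gh(1)] nonempty[OF gh(2)] by (auto simp: sum) (metis sum)
    finally show ?thesis by simp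
  qed
  have "roof_class Y \<in> iso (Hom K P Y) ?H"
    unfolding iso_def hom_def bij_betw_def using carrier inj add by auto
  then show ?thesis by (auto simp: is_iso_def)
qed

end


section \<open>The homotopy category\<close>

text \<open>
  A resolution is unbounded in general. The definition of the bounded homotopy category makes sense for
  all complexes, and its bounded objects are the category to be localized.
\<close>

definition homotopy_category where
  "homotopy_category A = (Kb A)\<lparr>Ob := {C. is_complex A C}\<rparr>"

context preadditive_category
begin

lemma ident_chain_map: "is_complex A C \<Longrightarrow> chain_map C C (\<lambda>i. Ident A (cob C i))"
  by (simp add: chain_map_iff)

lemma homotopy_category_preadditive: "preadditive_category (homotopy_category A)"
proof -
  have Hom: "Hom (homotopy_category A) = Hom (Kb A)" and Comp: "Comp (homotopy_category A) = Comp (Kb A)"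
    and Ob: "Ob (homotopy_category A) = {C. is_complex A C}"
    and Id: "Ident (homotopy_category A) C = homotopy_class A C C (\<lambda>i. Ident A (cob C i))" for C
    by (simp_all add: homotopy_category_def Kb_def)
  note Kbs = Kb_Comp Kb_Add comp_map_chain_map add_map_chain_map ident_chain_map
  show ?thesis
  proof (rule preadditive_category.intro, unfold Hom Comp Ob Id mem_Collect_eq, goal_cases)
    case (1 C D)
    interpret comm_group "chain_map_group A C D" using 1 by (rule chain_map_comm_group)
    show ?case
      using abelian_FactGroup normal_imp_subgroup[OF null_homotopic_normal[OF 1]] by (simp add: Kb_def)
  next
    case (2 C)
    then show ?case by (auto simp: Kb_Mor ident_chain_map)
  next
    case (3 C D E F G)
    then show ?case by (auto simp: Kb_Mor Kbs)
  next
    case (4 C D F)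
    then obtain f where f: "chain_map C D f" "F = homotopy_class A C D f" by (auto simp: Kb_Mor)
    have "comp_map C D D (\<lambda>i. Ident A (cob D i)) f = f"
      using 4 f by (simp add: comp_map_def)
    with 4 f show ?case by (simp add: Kbs)
  next
    case (5 C D F)
    then obtain f where f: "chain_map C D f" "F = homotopy_class A C D f" by (auto simp: Kb_Mor)
    have "comp_map C C D f (\<lambda>i. Ident A (cob C i)) = f"
      using 5 f by (simp add: comp_map_def)
    with 5 f show ?case by (simp add: Kbs)
  next
    case (6 B C D E F G H)
    then obtain f g h where f: "chain_map B C f" "F = homotopy_class A B C f"
      and g: "chain_map C D g" "G = homotopy_class A C D g"
      and h: "chain_map D E h" "H = homotopy_class A D E h" by (auto simp: Kb_Mor)
    have "comp_map B C E (comp_map C D E h g) f = comp_map B D E h (comp_map B C D g f)"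
      using 6 f g h by (simp add: comp_map_def Comp_assoc)
    with 6 f g h show ?case by (simp add: Kbs)
  next
    case (7 C D E F G H)
    then obtain f g h where f: "chain_map C D f" "F = homotopy_class A C D f"
      and g: "chain_map D E g" "G = homotopy_class A D E g"
      and h: "chain_map D E h" "H = homotopy_class A D E h" by (auto simp: Kb_Mor)
    have "comp_map C D E (add_map D E g h) f = add_map C E (comp_map C D E g f) (comp_map C D E h f)"
      using 7 f g h by (simp add: comp_map_def add_map_def Comp_Add_left)
    with 7 f g h show ?case by (simp add: Kbs)
  next
    case (8 C D E F G H)
    then obtain f g h where f: "chain_map C D f" "F = homotopy_class A C D f"
      and g: "chain_map C D g" "G = homotopy_class A C D g"
      and h: "chain_map D E h" "H = homotopy_class A D E h" by (auto simp: Kb_Mor)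
    have "comp_map C D E h (add_map C D f g) = add_map C E (comp_map C D E h f) (comp_map C D E h g)"
      using 8 f g h by (simp add: comp_map_def add_map_def Comp_Add_right)
    with 8 f g h show ?case by (simp add: Kbs)
  qed
qed

end

section \<open>Lifting along acyclic maps\<close>

lemma descending_choice:
  fixes R :: "int \<Rightarrow> 'a \<Rightarrow> bool" and Q :: "int \<Rightarrow> 'a \<Rightarrow> 'a \<Rightarrow> bool"
  assumes "\<exists>x. R 0 x"
    and "\<And>i x. \<lbrakk>i \<le> 0; R i x\<rbrakk> \<Longrightarrow> \<exists>y. R (i - 1) y \<and> Q i x y"
  obtains f where "\<And>i. i \<le> 0 \<Longrightarrow> R i (f i)" "\<And>i. i \<le> 0 \<Longrightarrow> Q i (f i) (f (i - 1))"
proof -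
  have "\<exists>g. \<forall>k. R (- int k) (g k) \<and> Q (- int k) (g k) (g (Suc k))"
  proof (rule dependent_nat_choice)
    show "\<exists>y. R (- int (Suc k)) y \<and> Q (- int k) x y" if "R (- int k) x" for x k
    proof -
      have *: "- int (Suc k) = - int k - 1" by simp
      have "- int k \<le> 0" by simp
      from assms(2)[OF this that] show ?thesis unfolding * .
    qed
  qed (use assms(1) in simp)
  then obtain g where g: "\<And>k. R (- int k) (g k)" "\<And>k. Q (- int k) (g k) (g (Suc k))"
    by blast
  have "R i (g (nat (- i)))" "Q i (g (nat (- i))) (g (nat (- (i - 1))))" if "i \<le> 0" for i
  proof -
    have "nat (- (i - 1)) = Suc (nat (- i))" using that by simp
    then show "R i (g (nat (- i)))" "Q i (g (nat (- i))) (g (nat (- (i - 1))))"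
      using g[of "nat (- i)"] that by simp_all
  qed
  then show ?thesis by (rule that[of "\<lambda>i. g (nat (- i))"])
qed

text \<open>
  An augmented proper resolution \<open>P \<rightarrow> T\<close>, with \<open>T\<close> concentrated in degree 0. The exactness of
  \<open>P \<rightarrow> T\<close> under \<open>Hom(X, _)\<close> is expressed by the same predicate that characterizes denominators.
\<close>

locale X_resolution = abelian_category A for A :: "('o, 'm) preadd" +
  fixes \<X> :: "'o set" and P T :: "('o, 'm) cpx" and aug :: "int \<Rightarrow> 'm"
  assumes X_Ob: "\<X> \<subseteq> Ob A" and P [simp]: "is_complex A P" and P_X: "i \<le> 0 \<Longrightarrow> cob P i \<in> \<X>"
    and P_zero: "i > 0 \<Longrightarrow> is_zero_ob A (cob P i)"
    and T: "concentrated T 0" and aug [simp]: "chain_map P T aug" and res: "resolves \<X> P T aug"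
begin

lemma T_complex [simp]: "is_complex A T"
  using T by (rule concentrated_complex)

lemma to_T_zero: "\<lbrakk>i \<noteq> 0; W \<in> Ob A; x \<in> Mor A W (cob T i)\<rbrakk> \<Longrightarrow> x = Zero A W (cob T i)"
  using to_zero_ob[OF concentrated_zero[OF T]] by simp

lemma from_P_zero: "\<lbrakk>i > 0; W \<in> Ob A; f \<in> Mor A (cob P i) W; g \<in> Mor A (cob P i) W\<rbrakk> \<Longrightarrow> f = g"
  using from_zero_ob[OF P_zero] by blast

text \<open>
  The comparison theorem. In degree 0 the surjectivity half of \<open>resolves\<close>, applied to \<open>X = P\<^sup>0\<close>, gives
  a lift of the augmentation; below, \<open>l\<^sup>i\<^sup>+\<^sup>1 d\<close> is a cycle in \<open>Hom(P\<^sup>i, Z)\<close> that \<open>s\<close> kills, hence of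
  the form \<open>d l\<^sup>i\<close>.
\<close>

lemma lift_exists:
  assumes Z [simp]: "is_complex A Z" and s [simp]: "chain_map Z T s" and rs: "resolves \<X> Z T s"
  shows "\<exists>l. chain_map P Z l \<and> comp_map P Z T s l = aug"
proof -
  \<comment> \<open>\<open>?R i x\<close>: the component \<open>x\<close> in degree \<open>i\<close> can be continued, because \<open>x d\<close> is a cycle killed by \<open>s\<close>.
    \<open>?Q i x y\<close>: the components \<open>x\<close> and \<open>y\<close> in degrees \<open>i\<close> and \<open>i - 1\<close> commute with the differentials.\<close>
  let ?R = "\<lambda>i x. x \<in> Mor A (cob P i) (cob Z i) \<and>
    Comp A (cob P (i - 1)) (cob Z i) (cob Z (i + 1)) (cdiff Z i)
      (Comp A (cob P (i - 1)) (cob P i) (cob Z i) x (cdiff P (i - 1))) = Zero A (cob P (i - 1)) (cob Z (i + 1)) \<and>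
    Comp A (cob P (i - 1)) (cob Z i) (cob T i) (s i)
      (Comp A (cob P (i - 1)) (cob P i) (cob Z i) x (cdiff P (i - 1))) = Zero A (cob P (i - 1)) (cob T i) \<and>
    (i = 0 \<longrightarrow> Comp A (cob P 0) (cob Z 0) (cob Z 1) (cdiff Z 0) x = Zero A (cob P 0) (cob Z 1) \<and>
      Comp A (cob P 0) (cob Z 0) (cob T 0) (s 0) x = aug 0)"
  let ?Q = "\<lambda>i x y. Comp A (cob P (i - 1)) (cob P i) (cob Z i) x (cdiff P (i - 1))
      = Comp A (cob P (i - 1)) (cob Z (i - 1)) (cob Z i) (cdiff Z (i - 1)) y"
  have base: "\<exists>x. ?R 0 x"
  proof -
    obtain x where [simp]: "x \<in> Mor A (cob P 0) (cob Z 0)"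
      and x: "Comp A (cob P 0) (cob Z 0) (cob Z 1) (cdiff Z 0) x = Zero A (cob P 0) (cob Z 1)"
        "Comp A (cob P 0) (cob Z 0) (cob T 0) (s 0) x = aug 0"
      using resolves_lift[OF rs P_X[of 0], of 1 0 "aug 0"] by auto
    have "Comp A (cob P (- 1)) (cob P 0) (cob T 0) (aug 0) (cdiff P (- 1)) = Zero A (cob P (- 1)) (cob T 0)"
      by (rule chain_map_to_concentrated_cdiff[OF T P aug]) simp
    then have "?R 0 x"
      using x by (simp flip: Comp_assoc)
    then show ?thesis by blast
  qed
  have step: "\<exists>y. ?R (i - 1) y \<and> ?Q i x y" if i: "i \<le> 0" and R: "?R i x" for i x
  proof -
    have [simp]: "x \<in> Mor A (cob P i) (cob Z i)" using R by blast
    let ?w = "Comp A (cob P (i - 1)) (cob P i) (cob Z i) x (cdiff P (i - 1))"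
    have "\<exists>y \<in> Mor A (cob P (i - 1)) (cob Z (i - 1)).
        Comp A (cob P (i - 1)) (cob Z (i - 1)) (cob Z i) (cdiff Z (i - 1)) y = ?w"
      by (rule resolves_lift_cycle[OF rs P_X, where j = "i + 1"]) (use i R in simp_all)
    then obtain y where [simp]: "y \<in> Mor A (cob P (i - 1)) (cob Z (i - 1))"
      and y: "Comp A (cob P (i - 1)) (cob Z (i - 1)) (cob Z i) (cdiff Z (i - 1)) y = ?w" by blast
    let ?v = "Comp A (cob P (i - 1 - 1)) (cob P (i - 1)) (cob Z (i - 1)) y (cdiff P (i - 1 - 1))"
    have "Comp A (cob P (i - 1 - 1)) (cob Z (i - 1)) (cob Z i) (cdiff Z (i - 1)) ?v
       = Comp A (cob P (i - 1 - 1)) (cob P (i - 1)) (cob Z i) ?w (cdiff P (i - 1 - 1))"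
      by (simp flip: Comp_assoc y)
    also have "\<dots> = Zero A (cob P (i - 1 - 1)) (cob Z i)" by (rule cdiff_cdiff_pre) simp_all
    finally have 1: "Comp A (cob P (i - 1 - 1)) (cob Z (i - 1)) (cob Z (i - 1 + 1)) (cdiff Z (i - 1)) ?v
       = Zero A (cob P (i - 1 - 1)) (cob Z (i - 1 + 1))" by simp
    have 2: "Comp A (cob P (i - 1 - 1)) (cob Z (i - 1)) (cob T (i - 1)) (s (i - 1)) ?v
       = Zero A (cob P (i - 1 - 1)) (cob T (i - 1))"
      using i by (intro to_T_zero) simp_all
    from 1 2 y i have "?R (i - 1) y \<and> ?Q i x y" by simp
    then show ?thesis by blast
  qed
  obtain g where g: "\<And>i. i \<le> 0 \<Longrightarrow> ?R i (g i)" and gQ: "\<And>i. i \<le> 0 \<Longrightarrow> ?Q i (g i) (g (i - 1))"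
    using descending_choice[of ?R ?Q, OF base step] by blast
  define l where "l = (\<lambda>i. if i \<le> 0 then g i else Zero A (cob P i) (cob Z i))"
  have l_mem [simp]: "l i \<in> Mor A (cob P i) (cob Z i)" for i
    using g[of i] by (simp add: l_def)
  have "Comp A (cob P i) (cob Z i) (cob Z (i + 1)) (cdiff Z i) (l i)
      = Comp A (cob P i) (cob P (i + 1)) (cob Z (i + 1)) (l (i + 1)) (cdiff P i)" for i
  proof -
    consider "i > 0" | "i = 0" | "i < 0" by linarith
    then show ?thesis
    proof cases
      case 1
      then show ?thesis by (intro from_P_zero[of i "cob Z (i + 1)"]) simp_all
    next
      case 2
      then show ?thesis using g[of 0] by (simp add: l_def)
    next
      case 3
      then show ?thesis using gQ[of "i + 1"] by (simp add: l_def)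
    qed
  qed
  then have l: "chain_map P Z l" by (simp add: chain_map_iff)
  moreover have "comp_map P Z T s l = aug"
    by (rule chain_map_to_concentrated_ext[OF T P])
      (use l g[of 0] in \<open>simp_all add: comp_map_chain_map, simp_all add: comp_map_def l_def\<close>)
  ultimately show ?thesis by blast
qed

text \<open>
  The difference \<open>\<delta>\<close> of two lifts is killed by \<open>s\<close>, and a contracting homotopy \<open>h\<close> is built downwards:
  \<open>\<delta>\<^sup>i - h\<^sup>i\<^sup>+\<^sup>1 d\<close> is a cycle that \<open>s\<close> kills, hence of the form \<open>d h\<^sup>i\<close>.
\<close>

lemma lift_unique:
  assumes Z [simp]: "is_complex A Z" and s [simp]: "chain_map Z T s" and rs: "resolves \<X> Z T s"
    and l [simp]: "chain_map P Z l" "chain_map P Z l'"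
    and eq: "Comp A (cob P 0) (cob Z 0) (cob T 0) (s 0) (l' 0) = Comp A (cob P 0) (cob Z 0) (cob T 0) (s 0) (l 0)"
  shows "l' \<in> homotopy_class A P Z l"
proof -
  define \<delta> where "\<delta> = (\<lambda>i. Add A (cob P i) (cob Z i) (l' i) (Neg A (cob P i) (cob Z i) (l i)))"
  have \<delta> [simp]: "chain_map P Z \<delta>"
    unfolding chain_map_iff \<delta>_def
    by (simp add: Comp_Add_left Comp_Add_right Comp_Neg_left Comp_Neg_right chain_map_commute)
  have s\<delta>: "Comp A (cob P 0) (cob Z 0) (cob T 0) (s 0) (\<delta> 0) = Zero A (cob P 0) (cob T 0)"
    by (simp add: \<delta>_def Comp_Add_right Comp_Neg_right eq)
  \<comment> \<open>\<open>?R i h\<close> asks for \<open>d h d = \<delta> d\<close> only, which follows from \<open>d h + h' d = \<delta>\<close> but does not mention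
    the component \<open>h'\<close> of the homotopy in degree \<open>i + 1\<close>.\<close>
  let ?R = "\<lambda>i h. h \<in> Mor A (cob P i) (cob Z (i - 1)) \<and>
    Comp A (cob P (i - 1)) (cob P i) (cob Z i)
      (Comp A (cob P i) (cob Z (i - 1)) (cob Z i) (cdiff Z (i - 1)) h) (cdiff P (i - 1))
     = Comp A (cob P (i - 1)) (cob P i) (cob Z i) (\<delta> i) (cdiff P (i - 1)) \<and>
    (i = 0 \<longrightarrow> Comp A (cob P i) (cob Z (i - 1)) (cob Z i) (cdiff Z (i - 1)) h = \<delta> i)"
  let ?Q = "\<lambda>i x y. \<delta> (i - 1) = Add A (cob P (i - 1)) (cob Z (i - 1))
      (Comp A (cob P (i - 1)) (cob Z (i - 1 - 1)) (cob Z (i - 1)) (cdiff Z (i - 1 - 1)) y)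
      (Comp A (cob P (i - 1)) (cob P i) (cob Z (i - 1)) x (cdiff P (i - 1)))"
  have base: "\<exists>h. ?R 0 h"
  proof -
    have "\<delta> 1 = Zero A (cob P 1) (cob Z 1)" by (intro from_P_zero[of 1 "cob Z 1"]) simp_all
    then have "Comp A (cob P 0) (cob Z 0) (cob Z 1) (cdiff Z 0) (\<delta> 0) = Zero A (cob P 0) (cob Z 1)"
      using chain_map_commute[OF \<delta>, of 1 0] by simp
    then have "\<exists>h \<in> Mor A (cob P 0) (cob Z (- 1)).
        Comp A (cob P 0) (cob Z (- 1)) (cob Z 0) (cdiff Z (- 1)) h = \<delta> 0"
      by (intro resolves_lift_cycle[OF rs P_X, where j = 1]) (simp_all add: s\<delta>)
    then show ?thesis by auto
  qed
  have step: "\<exists>y. ?R (i - 1) y \<and> ?Q i x y" if i: "i \<le> 0" and R: "?R i x" for i x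
  proof -
    have x [simp]: "x \<in> Mor A (cob P i) (cob Z (i - 1))" using R by blast
    let ?xd = "Comp A (cob P (i - 1)) (cob P i) (cob Z (i - 1)) x (cdiff P (i - 1))"
    define w where "w = Add A (cob P (i - 1)) (cob Z (i - 1)) (\<delta> (i - 1)) (Neg A (cob P (i - 1)) (cob Z (i - 1)) ?xd)"
    have [simp]: "w \<in> Mor A (cob P (i - 1)) (cob Z (i - 1))" by (simp add: w_def)
    have "Comp A (cob P (i - 1)) (cob Z (i - 1)) (cob Z i) (cdiff Z (i - 1)) w
      = Add A (cob P (i - 1)) (cob Z i) (Comp A (cob P (i - 1)) (cob P i) (cob Z i) (\<delta> i) (cdiff P (i - 1)))
         (Neg A (cob P (i - 1)) (cob Z i) (Comp A (cob P (i - 1)) (cob Z (i - 1)) (cob Z i) (cdiff Z (i - 1)) ?xd))"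
      using chain_map_commute[OF \<delta>, of i "i - 1"] by (simp add: w_def Comp_Add_right Comp_Neg_right)
    also have "Comp A (cob P (i - 1)) (cob Z (i - 1)) (cob Z i) (cdiff Z (i - 1)) ?xd
      = Comp A (cob P (i - 1)) (cob P i) (cob Z i) (\<delta> i) (cdiff P (i - 1))"
      using R by (simp flip: Comp_assoc)
    finally have dw: "Comp A (cob P (i - 1)) (cob Z (i - 1)) (cob Z i) (cdiff Z (i - 1)) w = Zero A (cob P (i - 1)) (cob Z i)"
      by simp
    have "\<exists>y \<in> Mor A (cob P (i - 1)) (cob Z (i - 1 - 1)).
        Comp A (cob P (i - 1)) (cob Z (i - 1 - 1)) (cob Z (i - 1)) (cdiff Z (i - 1 - 1)) y = w"
      by (rule resolves_lift_cycle[OF rs P_X, where j = i])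
        (use i dw in \<open>simp_all add: to_T_zero\<close>)
    then obtain y where ym: "y \<in> Mor A (cob P (i - 1)) (cob Z (i - 1 - 1))"
      and y: "Comp A (cob P (i - 1)) (cob Z (i - 1 - 1)) (cob Z (i - 1)) (cdiff Z (i - 1 - 1)) y = w" by blast
    have [simp]: "y \<in> Mor A (cob P (i - 1)) (cob Z (i - 2))" using ym by simp
    have Q: "?Q i x y" unfolding y by (simp add: w_def Add_assoc)
    have "Comp A (cob P (i - 1 - 1)) (cob P (i - 1)) (cob Z (i - 1)) ?xd (cdiff P (i - 1 - 1))
      = Zero A (cob P (i - 1 - 1)) (cob Z (i - 1))"
      by (rule cdiff_cdiff_pre) simp_all
    then have "Comp A (cob P (i - 1 - 1)) (cob P (i - 1)) (cob Z (i - 1)) w (cdiff P (i - 1 - 1))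
      = Comp A (cob P (i - 1 - 1)) (cob P (i - 1)) (cob Z (i - 1)) (\<delta> (i - 1)) (cdiff P (i - 1 - 1))"
      by (simp add: w_def Comp_Add_left Comp_Neg_left)
    with Q y i show ?thesis by (intro exI[of _ y]) simp
  qed
  obtain g where g: "\<And>i. i \<le> 0 \<Longrightarrow> ?R i (g i)" and gQ: "\<And>i. i \<le> 0 \<Longrightarrow> ?Q i (g i) (g (i - 1))"
    using descending_choice[of ?R ?Q, OF base step] by blast
  define h where "h = (\<lambda>i. if i \<le> 0 then g i else Zero A (cob P i) (cob Z (i - 1)))"
  have h [simp]: "htpy_family P Z h"
    by (rule htpy_familyI) (use g in \<open>simp add: h_def\<close>)
  have "\<delta> i = htpy P Z h i" for i
  proof -
    consider "i > 0" | "i = 0" | "i < 0" by linarith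
    then show ?thesis
    proof cases
      case 1
      then show ?thesis by (intro from_P_zero[of i "cob Z i"]) simp_all
    next
      case 2
      then show ?thesis using g[of 0] by (simp add: h_def htpy_def)
    next
      case 3
      then show ?thesis using gQ[of "i + 1"] by (simp add: h_def htpy_def)
    qed
  qed
  then have "l' i = Add A (cob P i) (cob Z i) (htpy P Z h i) (l i)" for i
    by (simp flip: \<open>\<And>i. \<delta> i = htpy P Z h i\<close>) (simp add: \<delta>_def Add_assoc)
  with h show ?thesis
    unfolding mem_homotopy_class_iff[OF P Z l(1)] by blast
qed

text \<open>
  A homotopy from \<open>P\<close> to \<open>T\<close> lives on \<open>P\<^sup>1 = 0\<close>.
\<close>

lemma homotopic_to_T_iff:
  assumes f [simp]: "chain_map P T f" "chain_map P T f'"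
  shows "homotopy_class A P T f = homotopy_class A P T f' \<longleftrightarrow> f 0 = f' 0"
proof -
  have "cdiff P 0 = Zero A (cob P 0) (cob P 1)"
    by (rule to_zero_ob[OF P_zero[of 1], of "cob P 0"]) simp_all
  moreover have "Zero A (cob P 1) (cob T 0) \<in> Mor A (cob P 1) (cob T 0)" by simp
  ultimately have "(\<exists>t \<in> Mor A (cob P 1) (cob T 0). f 0 = Add A (cob P 0) (cob T 0)
      (Comp A (cob P 0) (cob P 1) (cob T 0) t (cdiff P 0)) (f' 0)) \<longleftrightarrow> f 0 = f' 0"
    by (auto simp del: Zero_closed)
  then show ?thesis
    using homotopy_class_to_concentrated[OF T P f(2,1)] by (simp add: homotopy_class_eq_iff)
qed

lemma lift_ex1:
  assumes Z: "bounded_complex A Z" and S: "S \<in> Kb_denominators A \<X> Z T"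
  shows "\<exists>!L. L \<in> Mor (Kb A) P Z \<and> Comp (Kb A) P Z T S L = homotopy_class A P T aug"
proof -
  have [simp]: "is_complex A Z" using Z by simp
  obtain s where s [simp]: "chain_map Z T s" and rs: "resolves \<X> Z T s" and S_eq: "S = homotopy_class A Z T s"
    using S Kb_denominators_iff[OF X_Ob Z concentrated_bounded[OF T] concentrated_cdiff[OF T]] by blast
  have iff: "Comp (Kb A) P Z T S (homotopy_class A P Z l) = homotopy_class A P T aug \<longleftrightarrow>
      Comp A (cob P 0) (cob Z 0) (cob T 0) (s 0) (l 0) = aug 0" if [simp]: "chain_map P Z l" for l
    by (simp add: S_eq Kb_Comp homotopic_to_T_iff comp_map_chain_map) (simp add: comp_map_def)
  obtain l where l: "chain_map P Z l" "comp_map P Z T s l = aug"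
    using lift_exists[OF _ s rs] by auto
  have l0: "Comp A (cob P 0) (cob Z 0) (cob T 0) (s 0) (l 0) = aug 0"
    using fun_cong[OF l(2), of 0] by (simp add: comp_map_def)
  show ?thesis
  proof (rule ex1I[of _ "homotopy_class A P Z l"])
    show "homotopy_class A P Z l \<in> Mor (Kb A) P Z \<and>
        Comp (Kb A) P Z T S (homotopy_class A P Z l) = homotopy_class A P T aug"
      using l l0 iff by (auto simp: Kb_Mor)
    fix L assume L: "L \<in> Mor (Kb A) P Z \<and> Comp (Kb A) P Z T S L = homotopy_class A P T aug"
    then obtain l' where l': "chain_map P Z l'" "L = homotopy_class A P Z l'" by (auto simp: Kb_Mor)
    then have "l' \<in> homotopy_class A P Z l"
      using L iff l0 l by (intro lift_unique[OF _ s rs]) auto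
    then show "L = homotopy_class A P Z l"
      using l' l by (simp add: homotopy_class_eq_iff)
  qed
qed

end

section \<open>Truncated resolutions\<close>

context abelian_category
begin

lemma zero_ob_zero [simp]: "is_zero_ob A (zero_ob A)"
  unfolding zero_ob_def using ex_zero_ob by (rule someI_ex)

lemma zero_ob_mem [simp]: "zero_ob A \<in> Ob A"
  by (rule zero_ob_Ob) simp

lemma stalk_concentrated:
  assumes "M \<in> Ob A" shows "concentrated (stalk A M) 0"
  using assms by (simp add: concentrated_def stalk_def is_complex_def Let_def)

lemma shift_stalk_concentrated:
  assumes "N \<in> Ob A" shows "concentrated (shift A (stalk A N) n) (- n)"
proof -
  have "n + m = 0 \<longleftrightarrow> m = - n" for m by auto
  then show ?thesis
    using assms by (auto simp: concentrated_def shift_def stalk_def is_complex_def Let_def add.assoc)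
qed

end

text \<open>
  The canonical truncation of \<open>P\<close>: the degrees above \<open>j\<close> are kept, and \<open>K\<close>, meant to be the kernel of
  \<open>d\<^sup>j\<^sup>+\<^sup>1\<close>, is put in degree \<open>j\<close>. As kernels are preserved by \<open>Hom(X, _)\<close>, this truncation, unlike the
  brutal one, is exact under \<open>Hom(X, _)\<close> where \<open>P\<close> is.
\<close>

definition truncation :: "('o, 'm) preadd \<Rightarrow> ('o, 'm) cpx \<Rightarrow> int \<Rightarrow> 'o \<Rightarrow> 'm \<Rightarrow> ('o, 'm) cpx" where
  "truncation A P j K k = (let X = (\<lambda>i. if i > j then cob P i else if i = j then K else zero_ob A) in
    \<lparr>cob = X, cdiff = (\<lambda>i. if i > j then cdiff P i else if i = j then k else Zero A (X i) (X (i + 1)))\<rparr>)"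

locale truncated_resolution = X_resolution +
  fixes j :: int and K :: 'a and k c :: 'b
  assumes j: "j \<le> - 2" and ker: "is_kernel A (cob P (j + 1)) (cob P (j + 2)) (cdiff P (j + 1)) K k"
    and c [simp]: "c \<in> Mor A (cob P j) K" and kc: "Comp A (cob P j) K (cob P (j + 1)) k c = cdiff P j"
begin

abbreviation "W \<equiv> truncation A P j K k"

lemma W_simps:
  "i > j \<Longrightarrow> cob W i = cob P i" "i > j \<Longrightarrow> cdiff W i = cdiff P i"
  "cob W j = K" "cdiff W j = k"
  "i < j \<Longrightarrow> cob W i = zero_ob A" "i < j \<Longrightarrow> cdiff W i = Zero A (cob W i) (cob W (i + 1))"
  by (simp_all add: truncation_def Let_def)

lemma K [simp]: "K \<in> Ob A" and k [simp]: "k \<in> Mor A K (cob P (j + 1))"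
  and dk [simp]: "Comp A K (cob P (j + 1)) (cob P (j + 2)) (cdiff P (j + 1)) k = Zero A K (cob P (j + 2))"
  using ker by (simp_all add: is_kernel_def)

lemma k_mono:
  assumes [simp]: "X \<in> Ob A" "x \<in> Mor A X K" "y \<in> Mor A X K"
    and eq: "Comp A X K (cob P (j + 1)) k x = Comp A X K (cob P (j + 1)) k y"
  shows "x = y"
proof -
  let ?g = "Comp A X K (cob P (j + 1)) k y"
  have "Comp A X (cob P (j + 1)) (cob P (j + 2)) (cdiff P (j + 1)) ?g = Zero A X (cob P (j + 2))"
    by (simp flip: Comp_assoc)
  then have "\<exists>!h. h \<in> Mor A X K \<and> Comp A X K (cob P (j + 1)) k h = ?g"
    using ker by (simp add: is_kernel_def)
  with eq show ?thesis using assms(2,3) by blast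
qed

lemma index_cases:
  fixes i :: int
  obtains "i > j" | "i = j" | "i < j"
  by linarith

lemma W_complex [simp]: "is_complex A W"
proof -
  have ob: "cob W i \<in> Ob A" for i
    by (cases i rule: index_cases) (simp_all add: W_simps)
  have d: "cdiff W i \<in> Mor A (cob W i) (cob W (i + 1))" for i
    by (cases i rule: index_cases) (use ob in \<open>simp_all add: W_simps(1-4,6)\<close>)
  have "Comp A (cob W i) (cob W (i + 1)) (cob W (i + 2)) (cdiff W (i + 1)) (cdiff W i)
      = Zero A (cob W i) (cob W (i + 2))" for i
  proof (cases i rule: index_cases)
    case 3
    then show ?thesis using ob d[of "i + 1"] by (simp add: W_simps(6))
  qed (simp_all add: W_simps)
  with ob d show ?thesis by (simp only: is_complex_def) simp
qed

lemma W_bounded: "bounded_complex A W"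
proof -
  have "is_zero_ob A (cob W i)" if "i < j \<or> 0 < i" for i
    using that j P_zero by (auto simp: W_simps)
  then show ?thesis unfolding bounded_complex_def by auto
qed

definition q :: "int \<Rightarrow> 'b" where
  "q i = (if i > j then Ident A (cob P i) else if i = j then c else Zero A (cob P i) (cob W i))"

lemma q_chain_map [simp]: "chain_map P W q"
  unfolding chain_map_iff
proof (intro allI conjI)
  fix i
  show "q i \<in> Mor A (cob P i) (cob W i)"
    by (cases i rule: index_cases) (simp_all add: q_def W_simps)
  show "Comp A (cob P i) (cob W i) (cob W (i + 1)) (cdiff W i) (q i) =
      Comp A (cob P i) (cob P (i + 1)) (cob W (i + 1)) (q (i + 1)) (cdiff P i)"
  proof (cases i rule: index_cases)
    case 3
    show ?thesis
    proof (cases "i + 1 = j")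
      case True
      then have i: "i = j - 1" by simp
      have "Comp A (cob P (j - 1)) (cob P j) K c (cdiff P (j - 1)) = Zero A (cob P (j - 1)) K"
      proof (rule k_mono)
        have "Comp A (cob P (j - 1)) K (cob P (j + 1)) k (Comp A (cob P (j - 1)) (cob P j) K c (cdiff P (j - 1)))
          = Comp A (cob P (j - 1)) (cob P j) (cob P (j + 1)) (cdiff P j) (cdiff P (j - 1))"
          by (simp add: kc flip: Comp_assoc)
        then show "Comp A (cob P (j - 1)) K (cob P (j + 1)) k (Comp A (cob P (j - 1)) (cob P j) K c (cdiff P (j - 1)))
          = Comp A (cob P (j - 1)) K (cob P (j + 1)) k (Zero A (cob P (j - 1)) K)" by simp
      qed simp_all
      then show ?thesis unfolding i by (simp add: q_def W_simps)
    next
      case False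
      with 3 show ?thesis by (simp add: q_def W_simps(6))
    qed
  qed (simp_all add: q_def W_simps kc)
qed

definition w :: "int \<Rightarrow> 'b" where "w = single_map W T 0 (aug 0)"

lemma w_chain_map [simp]: "chain_map W T w"
  unfolding w_def
proof (rule single_map_chain_map[OF T W_complex])
  show "aug 0 \<in> Mor A (cob W 0) (cob T 0)" using j by (simp add: W_simps)
  show "Comp A (cob W (0 - 1)) (cob W 0) (cob T 0) (aug 0) (cdiff W (0 - 1)) = Zero A (cob W (0 - 1)) (cob T 0)"
    using j chain_map_to_concentrated_cdiff[OF T P aug, of "- 1"] by (simp add: W_simps)
qed

lemma w_0: "w 0 = aug 0"
  by (simp add: w_def single_map_def)

lemma w_q: "comp_map P W T w q = aug"
  by (rule chain_map_to_concentrated_ext[OF T P])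
    (simp_all add: comp_map_chain_map, use j in \<open>simp add: comp_map_def w_0 q_def W_simps\<close>)

text \<open>
  In degree \<open>j + 1\<close> exactness is the universal property of the kernel \<open>K\<close>, in degree \<open>j\<close> it holds because
  \<open>k\<close> is a monomorphism, and in higher degrees it is inherited from \<open>P\<close>.
\<close>

lemma w_resolves: "resolves \<X> W T w"
  unfolding resolves_def
proof (intro ballI allI conjI impI)
  fix X i x assume X: "X \<in> \<X>" and x: "x \<in> Mor A X (cob W i)"
    and dx: "Comp A X (cob W i) (cob W (i + 1)) (cdiff W i) x = Zero A X (cob W (i + 1))"
    and wx: "Comp A X (cob W i) (cob T i) (w i) x = Zero A X (cob T i)"
  have [simp]: "X \<in> Ob A" using X X_Ob by auto
  consider "i > j + 1" | "i = j + 1" | "i = j" | "i < j" by linarith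
  then show "\<exists>y \<in> Mor A X (cob W (i - 1)). Comp A X (cob W (i - 1)) (cob W i) (cdiff W (i - 1)) y = x"
  proof cases
    case 1
    have "Comp A X (cob P i) (cob T i) (aug i) x = Zero A X (cob T i)"
      using wx x 1 by (cases "i = 0") (simp_all add: w_0 W_simps to_T_zero)
    with 1 x dx show ?thesis
      using resolves_lift_cycle[OF res X, of "i + 1" i "i - 1" x] by (simp add: W_simps)
  next
    case 2
    then have "\<exists>!h. h \<in> Mor A X K \<and> Comp A X K (cob P (j + 1)) k h = x"
      using ker x dx by (simp add: is_kernel_def W_simps)
    with 2 show ?thesis by (auto simp: W_simps)
  next
    case 3
    then have "x = Zero A X (cob W i)"
      using x dx k_mono[of X x "Zero A X K"] by (simp add: W_simps)
    then show ?thesis by (intro bexI[of _ "Zero A X (cob W (i - 1))"]) simp_all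
  next
    case 4
    then have "x = Zero A X (cob W i)"
      using x to_zero_ob[of "zero_ob A" X x "Zero A X (zero_ob A)"] by (simp add: W_simps(5))
    then show ?thesis by (intro bexI[of _ "Zero A X (cob W (i - 1))"]) simp_all
  qed
next
  fix X i y assume X: "X \<in> \<X>" and y: "y \<in> Mor A X (cob T i)"
  have [simp]: "X \<in> Ob A" using X X_Ob by auto
  show "\<exists>x \<in> Mor A X (cob W i). Comp A X (cob W i) (cob W (i + 1)) (cdiff W i) x = Zero A X (cob W (i + 1)) \<and>
      Comp A X (cob W i) (cob T i) (w i) x = y"
  proof (cases "i = 0")
    case True
    then show ?thesis
      using resolves_lift[OF res X, of 1 0 y] y j by (simp add: W_simps w_0)
  next
    case False
    then show ?thesis
      using to_T_zero[OF False _ y] by (intro bexI[of _ "Zero A X (cob W i)"]) simp_all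
  qed
qed

text \<open>
  The map \<open>q\<close> is the identity above degree \<open>j\<close>, and a chain map into \<open>Y\<close> vanishes up to degree \<open>j + 1\<close>.
  The vanishing of \<open>Y\<close> in degree \<open>j + 1\<close> is what makes the restriction commute with the differential \<open>k\<close>
  of the truncation.
\<close>

lemma factor_exists:
  assumes Y [simp]: "is_complex A Y" and z: "\<And>i. i \<le> j + 1 \<Longrightarrow> is_zero_ob A (cob Y i)"
    and f [simp]: "chain_map P Y f"
  shows "\<exists>g. chain_map W Y g \<and> comp_map P W Y g q = f"
proof -
  define g where "g = (\<lambda>i. if i > j then f i else Zero A (cob W i) (cob Y i))"
  have g_mem [simp]: "g i \<in> Mor A (cob W i) (cob Y i)" for i
    by (simp add: g_def W_simps)
  have "Comp A (cob W i) (cob Y i) (cob Y (i + 1)) (cdiff Y i) (g i) =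
      Comp A (cob W i) (cob W (i + 1)) (cob Y (i + 1)) (g (i + 1)) (cdiff W i)" for i
  proof (cases "i > j")
    case True
    then show ?thesis by (simp add: g_def W_simps chain_map_commute)
  next
    case False
    then show ?thesis by (intro to_zero_ob[OF z[of "i + 1"], of "cob W i"]) simp_all
  qed
  then have g: "chain_map W Y g" by (simp add: chain_map_iff)
  have "comp_map P W Y g q i = f i" for i
  proof (cases "i > j")
    case True
    then show ?thesis by (simp add: comp_map_def g_def q_def W_simps)
  next
    case False
    then show ?thesis
      using comp_map_chain_map[OF P W_complex Y q_chain_map g]
      by (intro to_zero_ob[OF z[of i], of "cob P i"]) simp_all
  qed
  with g show ?thesis by auto
qed

lemma factor_unique:
  assumes Y [simp]: "is_complex A Y" and z: "\<And>i. i \<le> j + 1 \<Longrightarrow> is_zero_ob A (cob Y i)"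
    and g [simp]: "chain_map W Y g" "chain_map W Y g'"
    and h: "comp_map P W Y g' q \<in> homotopy_class A P Y (comp_map P W Y g q)"
  shows "g' \<in> homotopy_class A W Y g"
proof -
  obtain s where s [simp]: "htpy_family P Y s"
    and eq: "comp_map P W Y g' q = (\<lambda>i. Add A (cob P i) (cob Y i) (htpy P Y s i) (comp_map P W Y g q i))"
    using h unfolding mem_homotopy_class_iff[OF P Y comp_map_chain_map[OF P W_complex Y q_chain_map g(1)]] by blast
  define t where "t = (\<lambda>i. if i > j then s i else Zero A (cob W i) (cob Y (i - 1)))"
  have t [simp]: "htpy_family W Y t"
    by (rule htpy_familyI) (simp add: t_def W_simps)
  have "g' i = Add A (cob W i) (cob Y i) (htpy W Y t i) (g i)" for i
  proof (cases "i > j")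
    case True
    have "g' i \<in> Mor A (cob P i) (cob Y i)" "g i \<in> Mor A (cob P i) (cob Y i)"
      using True chain_map_mem[OF g(1), of i] chain_map_mem[OF g(2), of i] by (simp_all add: W_simps)
    with True show ?thesis
      using fun_cong[OF eq, of i] by (simp add: comp_map_def q_def W_simps htpy_def t_def)
  next
    case False
    then show ?thesis by (intro to_zero_ob[OF z[of i], of "cob W i"]) simp_all
  qed
  with t show ?thesis
    unfolding mem_homotopy_class_iff[OF W_complex Y g(1)] by blast
qed

lemma factor_bij:
  assumes Y [simp]: "is_complex A Y" and z: "\<And>i. i \<le> j + 1 \<Longrightarrow> is_zero_ob A (cob Y i)"
  shows "bij_betw (\<lambda>G. Comp (Kb A) P W Y G (homotopy_class A P W q)) (Mor (Kb A) W Y) (Mor (Kb A) P Y)"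
  unfolding bij_betw_def
proof
  show "inj_on (\<lambda>G. Comp (Kb A) P W Y G (homotopy_class A P W q)) (Mor (Kb A) W Y)"
    using factor_unique[OF Y z]
    by (auto simp: inj_on_def Kb_Mor Kb_Comp homotopy_class_eq_iff comp_map_chain_map)
  show "(\<lambda>G. Comp (Kb A) P W Y G (homotopy_class A P W q)) ` Mor (Kb A) W Y = Mor (Kb A) P Y"
  proof (intro equalityI subsetI)
    fix F assume "F \<in> (\<lambda>G. Comp (Kb A) P W Y G (homotopy_class A P W q)) ` Mor (Kb A) W Y"
    then show "F \<in> Mor (Kb A) P Y"
      by (auto simp: Kb_Mor Kb_Comp comp_map_chain_map)
  next
    fix F assume "F \<in> Mor (Kb A) P Y"
    then obtain f where f: "chain_map P Y f" "F = homotopy_class A P Y f" by (auto simp: Kb_Mor)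
    obtain g where g: "chain_map W Y g" "comp_map P W Y g q = f"
      using factor_exists[OF Y z f(1)] by blast
    then have "F = Comp (Kb A) P W Y (homotopy_class A W Y g) (homotopy_class A P W q)"
      using f by (simp add: Kb_Comp)
    with g show "F \<in> (\<lambda>G. Comp (Kb A) P W Y G (homotopy_class A P W q)) ` Mor (Kb A) W Y"
      by (auto simp: Kb_Mor)
  qed
qed

end

context X_resolution
begin

lemma common_bound:
  assumes "finite \<Y>" "\<Y> \<subseteq> {Y. bounded_complex A Y}"
  shows "\<exists>a. \<forall>Y \<in> \<Y>. \<forall>i \<le> a. is_zero_ob A (cob Y i)"
  using assms
proof (induction rule: finite_induct)
  case (insert Y \<Y>)
  then obtain a where a: "\<forall>Y \<in> \<Y>. \<forall>i \<le> a. is_zero_ob A (cob Y i)" by auto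
  obtain b where b: "\<forall>i < b. is_zero_ob A (cob Y i)"
    using insert.prems by (auto simp: bounded_complex_def)
  show ?case using a b by (intro exI[of _ "min a (b - 1)"]) auto
qed simp

lemma approx_exists:
  assumes "finite \<Y>" "\<Y> \<subseteq> {Y. bounded_complex A Y}"
  shows "\<exists>W \<in> {Y. bounded_complex A Y}. \<exists>w \<in> Kb_denominators A \<X> W T. \<exists>q \<in> Mor (Kb A) P W.
    Comp (Kb A) P W T w q = homotopy_class A P T aug \<and>
    (\<forall>Y \<in> \<Y>. bij_betw (\<lambda>g. Comp (Kb A) P W Y g q) (Mor (Kb A) W Y) (Mor (Kb A) P Y))"
proof -
  obtain a where a: "\<forall>Y \<in> \<Y>. \<forall>i \<le> a. is_zero_ob A (cob Y i)"
    using common_bound[OF assms] by blast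
  \<comment> \<open>The bound \<open>- 2\<close> keeps degrees 0 and \<open>- 1\<close> of \<open>P\<close> unchanged, as the augmentation of the truncation
    requires; the bound \<open>a - 1\<close> makes all complexes of \<open>\<Y>\<close> vanish up to degree \<open>j + 1\<close>.\<close>
  define j where "j = min (- 2) (a - 1)"
  obtain K k where ker: "is_kernel A (cob P (j + 1)) (cob P (j + 2)) (cdiff P (j + 1)) K k"
    using ex_kernel[of "cob P (j + 1)" "cob P (j + 2)" "cdiff P (j + 1)"] by auto
  have "Comp A (cob P j) (cob P (j + 1)) (cob P (j + 2)) (cdiff P (j + 1)) (cdiff P j) = Zero A (cob P j) (cob P (j + 2))"
    and "cob P j \<in> Ob A" "cdiff P j \<in> Mor A (cob P j) (cob P (j + 1))" by simp_all
  then obtain c where "c \<in> Mor A (cob P j) K" "Comp A (cob P j) K (cob P (j + 1)) k c = cdiff P j"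
    using ker unfolding is_kernel_def by blast
  then interpret truncated_resolution A \<X> P T aug j K k c
    using ker by unfold_locales (simp_all add: j_def)
  have "homotopy_class A W T w \<in> Kb_denominators A \<X> W T"
    using Kb_denominators_iff[OF X_Ob W_bounded concentrated_bounded[OF T] concentrated_cdiff[OF T]]
      w_chain_map w_resolves by blast
  moreover have "Comp (Kb A) P W T (homotopy_class A W T w) (homotopy_class A P W q) = homotopy_class A P T aug"
    by (simp add: Kb_Comp w_q)
  moreover have "homotopy_class A P W q \<in> Mor (Kb A) P W"
    by (auto simp: Kb_Mor)
  moreover have "bij_betw (\<lambda>g. Comp (Kb A) P W Y g (homotopy_class A P W q)) (Mor (Kb A) W Y) (Mor (Kb A) P Y)"
    if "Y \<in> \<Y>" for Y
    using that a assms(2) by (intro factor_bij) (auto simp: j_def)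
  ultimately show ?thesis using W_bounded by blast
qed

theorem Hom_Db_iso:
  assumes Y: "bounded_complex A Y"
  shows "Hom (Kb A) P Y \<cong> Hom (Db A \<X>) T Y"
proof -
  let ?H = "homotopy_category A"
  have Hom: "Hom ?H = Hom (Kb A)" and Comp: "Comp ?H = Comp (Kb A)" and Ob: "Ob ?H = {C. is_complex A C}"
    and Kb: "?H\<lparr>Ob := {C. bounded_complex A C}\<rparr> = Kb A"
    by (simp_all add: homotopy_category_def Kb_def)
  interpret H: preadditive_category ?H by (rule homotopy_category_preadditive)
  interpret L: localizing_resolution ?H "{C. bounded_complex A C}" "Kb_denominators A \<X>" P T "homotopy_class A P T aug"
  proof (unfold_locales, unfold Hom Comp Ob)
    show "homotopy_class A P T aug \<in> Mor (Kb A) P T" by (auto simp: Kb_Mor)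
    show "Kb_denominators A \<X> Z T \<subseteq> Mor (Kb A) Z T" for Z by (auto simp: Kb_denominators_def)
  qed (use approx_exists lift_ex1 concentrated_bounded[OF T] in auto)
  show ?thesis
    using L.Hom_localization_iso[of Y] Y unfolding Kb Hom Db_def by simp
qed

end


section \<open>Relative Ext groups as homotopy classes\<close>

lemma iso_Mod:
  assumes \<phi>: "\<phi> \<in> iso G H" and G: "group G" and N: "N \<subseteq> carrier G"
  shows "G Mod N \<cong> H Mod (\<phi> ` N)"
proof -
  have hom: "\<phi> \<in> hom G H" and inj: "inj_on \<phi> (carrier G)" and surj: "\<phi> ` carrier G = carrier H"
    using \<phi> by (auto simp: iso_def bij_betw_def)
  have mult: "\<phi> (x \<otimes>\<^bsub>G\<^esub> y) = \<phi> x \<otimes>\<^bsub>H\<^esub> \<phi> y" if "x \<in> carrier G" "y \<in> carrier G" for x y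
    using hom that by (simp add: hom_mult)
  have coset: "\<phi> ` (N #>\<^bsub>G\<^esub> x) = \<phi> ` N #>\<^bsub>H\<^esub> \<phi> x" if "x \<in> carrier G" for x
  proof -
    have "\<phi> ` (N #>\<^bsub>G\<^esub> x) = (\<Union>h \<in> N. {\<phi> (h \<otimes>\<^bsub>G\<^esub> x)})"
      by (auto simp: r_coset_def)
    also have "\<dots> = (\<Union>h \<in> N. {\<phi> h \<otimes>\<^bsub>H\<^esub> \<phi> x})"
      using N that by (intro SUP_cong refl) (simp add: mult subset_iff)
    also have "\<dots> = \<phi> ` N #>\<^bsub>H\<^esub> \<phi> x"
      by (auto simp: r_coset_def)
    finally show ?thesis .
  qed
  have sub: "N #>\<^bsub>G\<^esub> x \<subseteq> carrier G" if "x \<in> carrier G" for x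
    using G N that by (simp add: group.is_monoid monoid.r_coset_subset_G)
  have "image \<phi> \<in> iso (G Mod N) (H Mod (\<phi> ` N))"
  proof (rule isoI)
    show "image \<phi> \<in> hom (G Mod N) (H Mod (\<phi> ` N))"
    proof (rule homI)
      show "\<phi> ` C \<in> carrier (H Mod \<phi> ` N)" if "C \<in> carrier (G Mod N)" for C
        using that by (auto simp: carrier_FactGroup coset simp flip: surj)
      show "\<phi> ` (C \<otimes>\<^bsub>G Mod N\<^esub> D) = \<phi> ` C \<otimes>\<^bsub>H Mod \<phi> ` N\<^esub> \<phi> ` D"
        if "C \<in> carrier (G Mod N)" "D \<in> carrier (G Mod N)" for C D
      proof -
        have C: "C \<subseteq> carrier G" and D: "D \<subseteq> carrier G" using that sub by (auto simp: carrier_FactGroup)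
        have "\<phi> ` (C <#>\<^bsub>G\<^esub> D) = (\<Union>x \<in> C. \<Union>y \<in> D. {\<phi> (x \<otimes>\<^bsub>G\<^esub> y)})"
          by (auto simp: set_mult_def)
        also have "\<dots> = (\<Union>x \<in> C. \<Union>y \<in> D. {\<phi> x \<otimes>\<^bsub>H\<^esub> \<phi> y})"
          using C D by (intro SUP_cong refl) (simp add: mult subset_iff)
        also have "\<dots> = \<phi> ` C <#>\<^bsub>H\<^esub> \<phi> ` D"
          by (auto simp: set_mult_def)
        finally show ?thesis by simp
      qed
    qed
    have "inj_on (image \<phi>) (carrier (G Mod N))"
    proof (rule inj_onI)
      fix C D assume "C \<in> carrier (G Mod N)" "D \<in> carrier (G Mod N)" and eq: "\<phi> ` C = \<phi> ` D"
      then have "C \<subseteq> carrier G" "D \<subseteq> carrier G" using sub by (auto simp: carrier_FactGroup)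
      with eq show "C = D" by (simp add: inj_on_image_eq_iff[OF inj])
    qed
    moreover have "image \<phi> ` carrier (G Mod N) = carrier (H Mod (\<phi> ` N))"
      by (auto simp: carrier_FactGroup image_image coset simp flip: surj)
    ultimately show "bij_betw (image \<phi>) (carrier (G Mod N)) (carrier (H Mod (\<phi> ` N)))"
      by (simp add: bij_betw_def)
  qed
  then show ?thesis by (auto simp: is_iso_def)
qed

context preadditive_category
begin

text \<open>
  A chain map from \<open>P\<close> to a complex concentrated in degree \<open>- n\<close> is a cocycle \<open>P\<^sup>-\<^sup>n \<rightarrow> N\<close>, and it is
  null-homotopic iff the cocycle factors through \<open>d : P\<^sup>-\<^sup>n \<rightarrow> P\<^sup>-\<^sup>n\<^sup>+\<^sup>1\<close>, that is, iff it is a coboundary.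
\<close>

lemma rel_Ext_iso:
  assumes P [simp]: "is_complex A P" and Y: "concentrated Y (- n)"
  shows "Hom (Kb A) P Y \<cong> rel_Ext A P (cob Y (- n)) n"
proof -
  let ?N = "cob Y (- n)"
  let ?C = "chain_map_group A P Y"
  note [simp] = concentrated_complex[OF Y]
  let ?Z = "(Hom A (cob P (- n)) ?N)\<lparr>carrier := {\<phi> \<in> Mor A (cob P (- n)) ?N.
    Comp A (cob P (- n - 1)) (cob P (- n)) ?N \<phi> (cdiff P (- n - 1)) = Zero A (cob P (- n - 1)) ?N}\<rparr>"
  let ?B = "(\<lambda>t. Comp A (cob P (- n)) (cob P (1 - n)) ?N t (cdiff P (- n))) ` Mor A (cob P (1 - n)) ?N"
  let ?ev = "\<lambda>f :: int \<Rightarrow> 'm. f (- n)"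
  have cocycle: "Comp A (cob P (- n - 1)) (cob P (- n)) ?N (f (- n)) (cdiff P (- n - 1)) = Zero A (cob P (- n - 1)) ?N"
    if "chain_map P Y f" for f
    using chain_map_to_concentrated_cdiff[OF Y P that, of "- n - 1"] by simp
  have single: "chain_map P Y (single_map P Y (- n) \<phi>)" if "\<phi> \<in> carrier ?Z" for \<phi>
    using that by (intro single_map_chain_map[OF Y P]) simp_all
  have ev: "?ev \<in> iso ?C ?Z"
  proof (rule isoI)
    show "?ev \<in> hom ?C ?Z"
      by (rule homI) (auto simp: cocycle simp flip: chain_map_def, simp add: chain_map_group_def)
    show "bij_betw ?ev (carrier ?C) (carrier ?Z)"
    proof (rule bij_betwI[where g = "single_map P Y (- n)"])
      show "single_map P Y (- n) (?ev f) = f" if "f \<in> carrier ?C" for f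
      proof -
        have f: "chain_map P Y f" using that by (simp add: chain_map_def)
        then have "chain_map P Y (single_map P Y (- n) (f (- n)))" using cocycle by (intro single) simp
        with f show ?thesis
          by (intro chain_map_to_concentrated_ext[OF Y P]) (simp_all add: single_map_def)
      qed
    qed (use single cocycle in \<open>auto simp: single_map_def simp flip: chain_map_def\<close>)
  qed
  have zero: "chain_map P Y (\<lambda>i. Zero A (cob P i) (cob Y i))"
    by (simp add: chain_map_iff)
  have null: "f \<in> null_homotopic A P Y \<longleftrightarrow> chain_map P Y f \<and> f (- n) \<in> ?B" for f
  proof -
    interpret N: normal "null_homotopic A P Y" ?C by (rule null_homotopic_normal) simp_all
    have "homotopy_class A P Y (\<lambda>i. Zero A (cob P i) (cob Y i)) = null_homotopic A P Y"
      using N.coset_mult_one[OF N.subset] by (simp add: homotopy_class_def chain_map_group_def)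
    then have "f \<in> null_homotopic A P Y \<longleftrightarrow> chain_map P Y f \<and> f \<in> homotopy_class A P Y (\<lambda>i. Zero A (cob P i) (cob Y i))"
      by (auto simp: null_homotopic_iff)
    also have "\<dots> \<longleftrightarrow> chain_map P Y f \<and> f (- n) \<in> ?B"
      using homotopy_class_to_concentrated[OF Y P zero] by (auto simp: image_iff)
    finally show ?thesis .
  qed
  have "?ev ` null_homotopic A P Y = ?B"
  proof (intro equalityI subsetI)
    fix \<phi> assume \<phi>: "\<phi> \<in> ?B"
    then have "\<phi> \<in> carrier ?Z" by auto
    then have "single_map P Y (- n) \<phi> \<in> null_homotopic A P Y"
      using \<phi> single by (simp add: null single_map_def)
    then show "\<phi> \<in> ?ev ` null_homotopic A P Y"
      by (rule rev_image_eqI) (simp add: single_map_def)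
  qed (auto simp: null)
  moreover have "rel_Ext A P ?N n = ?Z Mod ?B"
    by (simp add: rel_Ext_def cohomology_group_def kernel_def)
  moreover have "Hom (Kb A) P Y = ?C Mod null_homotopic A P Y"
    by (simp add: Kb_def)
  moreover have "?C Mod null_homotopic A P Y \<cong> ?Z Mod (?ev ` null_homotopic A P Y)"
    by (rule iso_Mod[OF ev])
      (use chain_map_comm_group[of P Y] in \<open>auto simp: comm_group_def null simp flip: chain_map_def\<close>)
  ultimately show ?thesis by simp
qed

end


section \<open>Proper resolutions\<close>

context abelian_category
begin

text \<open>
  The exactness of \<open>\<dots> \<rightarrow> P\<^sup>-\<^sup>1 \<rightarrow> P\<^sup>0 \<rightarrow> M \<rightarrow> 0\<close> under \<open>Hom(X, _)\<close> says that the augmentation induces a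
  bijection from the cohomology of \<open>Hom(X, P)\<close> to \<open>Hom(X, M)\<close>. In degree 1 of the augmented complex,
  where every morphism to \<open>M\<close> is a cycle, it gives surjectivity.
\<close>

lemma proper_resolution_X_resolution:
  assumes X: "additive_subcategory A \<X>" and M [simp]: "M \<in> Ob A" and pr: "is_proper_resolution A \<X> M P"
  shows "\<exists>aug. X_resolution A \<X> P (stalk A M) aug"
proof -
  have [simp]: "is_complex A P" and PX: "\<And>i. i \<le> 0 \<Longrightarrow> cob P i \<in> \<X>"
    and P0: "\<And>i. i > 0 \<Longrightarrow> is_zero_ob A (cob P i)"
    using pr by (auto simp: is_proper_resolution_def is_resolution_def)
  have X_Ob: "\<X> \<subseteq> Ob A" using X by (simp add: additive_subcategory_def)
  obtain e where e: "is_cokernel A (cob P (- 1)) (cob P 0) (cdiff P (- 1)) M e"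
    and ac: "is_X_acyclic A \<X> (augmented A P M e)"
    using pr by (auto simp: is_proper_resolution_def)
  have e_mem [simp]: "e \<in> Mor A (cob P 0) M"
    and ed [simp]: "Comp A (cob P (- 1)) (cob P 0) M e (cdiff P (- 1)) = Zero A (cob P (- 1)) M"
    using e by (simp_all add: is_cokernel_def)
  let ?E = "augmented A P M e"
  have E: "cob ?E i = (if i \<le> 0 then cob P i else if i = 1 then M else zero_ob A)"
    "cdiff ?E i = (if i < 0 then cdiff P i else if i = 0 then e else Zero A (cob ?E i) (cob ?E (i + 1)))" for i
    by (simp_all add: augmented_def Let_def)
  have ob: "cob ?E i \<in> Ob A" for i by (simp add: E(1))
  have d: "cdiff ?E i \<in> Mor A (cob ?E i) (cob ?E (i + 1))" for i
    using ob by (auto simp: E)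
  have "Comp A (cob ?E i) (cob ?E (i + 1)) (cob ?E (i + 2)) (cdiff ?E (i + 1)) (cdiff ?E i)
      = Zero A (cob ?E i) (cob ?E (i + 2))" for i
  proof -
    consider "i < -1" | "i = -1" | "i \<ge> 0" by linarith
    then show ?thesis
    proof cases
      case 3
      then have "cdiff ?E (i + 1) = Zero A (cob ?E (i + 1)) (cob ?E (i + 2))" by (simp add: E)
      then show ?thesis using ob d[of i] by simp
    qed (simp_all add: E)
  qed
  with ob d have E_complex: "is_complex A ?E" by (simp only: is_complex_def) simp
  let ?T = "stalk A M"
  have T: "concentrated ?T 0" by (rule stalk_concentrated) simp
  note [simp] = concentrated_complex[OF T]
  have [simp]: "cob ?T 0 = M" by (simp add: stalk_def Let_def)
  define aug where "aug = single_map P ?T 0 e"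
  have aug [simp]: "chain_map P ?T aug"
    unfolding aug_def by (rule single_map_chain_map[OF T]) simp_all
  have aug0: "aug 0 = e" by (simp add: aug_def single_map_def)
  have bdry: "\<exists>y \<in> Mor A X (cob ?E (i - 1)). Comp A X (cob ?E (i - 1)) (cob ?E i) (cdiff ?E (i - 1)) y = x"
    if "X \<in> \<X>" "x \<in> Mor A X (cob ?E i)"
      "Comp A X (cob ?E i) (cob ?E (i + 1)) (cdiff ?E i) x = Zero A X (cob ?E (i + 1))" for X i x
    using ac that unfolding X_acyclic_iff[OF E_complex X_Ob] by blast
  have "resolves \<X> P ?T aug"
    unfolding resolves_def
  proof (intro ballI allI conjI impI)
    fix X i x assume X: "X \<in> \<X>" and x: "x \<in> Mor A X (cob P i)"
      and dx: "Comp A X (cob P i) (cob P (i + 1)) (cdiff P i) x = Zero A X (cob P (i + 1))"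
      and ax: "Comp A X (cob P i) (cob ?T i) (aug i) x = Zero A X (cob ?T i)"
    have [simp]: "X \<in> Ob A" using X X_Ob by auto
    consider "i > 0" | "i = 0" | "i < 0" by linarith
    then show "\<exists>y \<in> Mor A X (cob P (i - 1)). Comp A X (cob P (i - 1)) (cob P i) (cdiff P (i - 1)) y = x"
    proof cases
      case 1
      then have "x = Zero A X (cob P i)"
        using x by (intro to_zero_ob[OF P0, of i X]) simp_all
      then show ?thesis by (intro bexI[of _ "Zero A X (cob P (i - 1))"]) simp_all
    next
      case 2
      then show ?thesis using bdry[OF X, of x 0] x ax by (simp add: E aug0)
    next
      case 3
      then show ?thesis using bdry[OF X, of x i] x dx by (simp add: E)
    qed
  next
    fix X i y assume X: "X \<in> \<X>" and y: "y \<in> Mor A X (cob ?T i)"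
    have [simp]: "X \<in> Ob A" using X X_Ob by auto
    show "\<exists>x \<in> Mor A X (cob P i). Comp A X (cob P i) (cob P (i + 1)) (cdiff P i) x = Zero A X (cob P (i + 1)) \<and>
        Comp A X (cob P i) (cob ?T i) (aug i) x = y"
    proof (cases "i = 0")
      case True
      obtain x where x: "x \<in> Mor A X (cob P 0)" "Comp A X (cob P 0) M e x = y"
        using bdry[OF X, of y 1] y True by (auto simp: E)
      moreover have "Comp A X (cob P 0) (cob P 1) (cdiff P 0) x = Zero A X (cob P 1)"
        using x by (intro to_zero_ob[OF P0[of 1], of X]) simp_all
      ultimately show ?thesis using True by (auto simp: aug0)
    next
      case False
      have "y = Zero A X (cob ?T i)"
        by (rule to_zero_ob[OF concentrated_zero[OF T False] _ y]) simp_all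
      then show ?thesis by (intro bexI[of _ "Zero A X (cob P i)"]) simp_all
    qed
  qed
  then have "X_resolution A \<X> P ?T aug"
    using X_Ob PX P0 T by unfold_locales simp_all
  then show ?thesis by blast
qed

end

theorem mainTheorem2:
  fixes A :: "('o, 'm) preadd" and \<X> :: "'o set" and M N :: 'o
    and P :: "('o, 'm) cpx" and n :: int
  assumes "abelian_category A"
    and "enough_projectives A"
    and "additive_subcategory A \<X>"
    and "M \<in> Ob A" and "N \<in> Ob A"
    and "is_proper_resolution A \<X> M P"
  shows "rel_Ext A P N n \<cong> Hom (Db A \<X>) (stalk A M) (shift A (stalk A N) n)"
proof -
  interpret abelian_category A by fact
  let ?Y = "shift A (stalk A N) n"
  obtain aug where "X_resolution A \<X> P (stalk A M) aug"
    using proper_resolution_X_resolution[OF assms(3,4,6)] by blast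
  then interpret X_resolution A \<X> P "stalk A M" aug .
  have Y: "concentrated ?Y (- n)"
    using assms(5) by (rule shift_stalk_concentrated)
  have "cob ?Y (- n) = N"
    by (simp add: shift_def stalk_def Let_def)
  then have "Hom (Kb A) P ?Y \<cong> rel_Ext A P N n"
    using rel_Ext_iso[OF P Y] by simp
  moreover have "group (Hom (Kb A) P ?Y)"
    using normal.factorgroup_is_group[OF null_homotopic_normal[OF P concentrated_complex[OF Y]]]
    by (simp add: Kb_def)
  ultimately have "rel_Ext A P N n \<cong> Hom (Kb A) P ?Y"
    using group.iso_sym by blast
  also have "\<dots> \<cong> Hom (Db A \<X>) (stalk A M) ?Y"
    by (rule Hom_Db_iso) (rule concentrated_bounded[OF Y])
  finally show ?thesis .
qed

end
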